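(* Let $t\mapsto Y(t)$ be the Markovian flight process in $\mathbb{R}^3$ and, for $r>0$, let $t\mapsto X^{r}(t)$ be the annealed Lorentz process with scatterers of radius $r$, realised as the Lorentz exploration process coupled to $Y$ (all as defined in the context). Let $T=T(r)>0$ be such that $\lim_{r\to0}T(r)=\infty$ and $\lim_{r\to0} r\,T(r)=0$. Then $$\lim_{r\to0}\mathbf{P}\big(\inf\{t: X^{r}(t)\neq Y(t)\}\le T(r)\big)=0 .$$
   Context: **Markovian flight process.** Let $\xi_j\in\mathbb{R}_+$, $u_j\in S^2\subset\mathbb{R}^3$ ($j=0,1,2,\dots$) be completely independent random variables, $\xi_j\sim EXP(1)$ (exponential of rate 1) and $u_j\sim UNI(S^2)$ (uniform on the unit sphere). Put $\tau_0=0$, $\tau_n=\sum_{j=1}^n\xi_j$, $Y_n=\sum_{j=1}^n\xi_ju_j$ and $Y(t)=Y_n+(t-\tau_n)u_{n+1}$ for $\tau_n\le t<\tau_{n+1}$. The process $Y$ does not depend on $r$. **Lorentz exploration process.** Fix $r>0$. The process $X=X^r$, with velocity $V=\dot X$, is constructed from the same variables $(\xi_j,u_j)$, inductively on the intervals $[\tau_{n-1},\tau_n)$. Let $\bigstar$ be a fictitious point at infinite distance from every point of $\mathbb{R}^3$ (a scatterer "centred at $\bigstar$" is absent). $f(t^\pm)$ denotes the one-sided limits. Step 1. $X(0)=0$, $V(0^+)=u_1$, $X'_0=r\frac{u_0-u_1}{|u_0-u_1|}$, $\mathcal{S}_0=\{X'_0\}$. Step 2. Given $X(\tau_{n-1})$,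 $V(\tau_{n-1}^+)$ and $\mathcal{S}_{n-1}=\{X'_0,\dots,X'_{n-1}\}\subset\mathbb{R}^3\cup\{\bigstar\}$, the trajectory on $[\tau_{n-1},\tau_n)$ is that of a point particle flying freely at unit speed and colliding elastically with fixed spherical scatterers of radius $r$ centred at the points of $\mathcal{S}_{n-1}$. This yields $X_n:=X(\tau_n)$ and $V(\tau_n^-)$. Step 3. Let $X''_n=X_n+r\frac{V(\tau_n^-)-u_{n+1}}{|V(\tau_n^-)-u_{n+1}|}$ and $d_n=\min_{0\le s<\tau_n}|X(s)-X''_n|$ (so $d_n\le r$). If $d_n<r$, set $X'_n=\bigstar$, $V(\tau_n^+)=V(\tau_n^-)$. If $d_n=r$, set $X'_n=X''_n$, $V(\tau_n^+)=u_{n+1}$. Put $\mathcal{S}_n=\mathcal{S}_{n-1}\cup\{X'_n\}$ and return to Step 2. With probability 1 this is well defined for all times. $X^r$ is a realisation of the averaged-quenched (annealed) random Lorentz gas trajectory: that of a point particle started at the origin with uniformly distributed unit velocity and colliding elastically with fixed spherical scatterers of radius $r$ centred at the points of a Poisson point process of intensity $\varrho=(\pi r^2)^{-1}$ (mean free path 1) in the complement of the ball of radius $r$ about the origin, with the convention that the trajectory begins with a collision at time $0$ (the extra scatterer centred at $X_0'$). *)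

theory Defs
  imports "HOL-Probability.Probability"
begin

type_synonym R3 = "real ^ 3"

text \<open>
  The uniform distribution on the unit sphere is the law of \<open>z / \<bar>z\<bar>\<close>
  for \<open>z\<close> uniform in the unit ball (normalised cone measure).
\<close>

definition uniform_sphere :: "R3 measure" where
  "uniform_sphere = distr (uniform_measure lborel (ball 0 1)) borel sgn"

definition flight_variables ::
  "'a measure \<Rightarrow> (nat \<Rightarrow> 'a \<Rightarrow> real) \<Rightarrow> (nat \<Rightarrow> 'a \<Rightarrow> R3) \<Rightarrow> bool" where
  "flight_variables M \<xi> u \<longleftrightarrow>
     prob_space M \<and>
     (\<forall>j. \<xi> j \<in> borel_measurable M \<and> distributed M lborel (\<xi> j) (exponential_density 1)) \<and>
     (\<forall>j. u j \<in> borel_measurable M \<and> distr M borel (u j) = uniform_sphere) \<and>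
     prob_space.indep_sets M
       (\<lambda>i. case i of
               Inl j \<Rightarrow> {\<xi> j -` A \<inter> space M | A. A \<in> sets borel}
             | Inr j \<Rightarrow> {u j -` A \<inter> space M | A. A \<in> sets borel})
       (UNIV :: (nat + nat) set)"


text \<open>
  From here on everything is defined for one realisation of the variables, i.e. for
  deterministic sequences \<open>\<xi>\<close> and \<open>u\<close>.  The index \<open>0\<close> entry of \<open>\<xi>\<close> is never used.
\<close>

definition flight_time :: "(nat \<Rightarrow> real) \<Rightarrow> nat \<Rightarrow> real" where
  "flight_time \<xi> n = (\<Sum>j=1..n. \<xi> j)"

definition flight_index :: "(nat \<Rightarrow> real) \<Rightarrow> real \<Rightarrow> nat" where
  "flight_index \<xi> t = (THE n. flight_time \<xi> n \<le> t \<and> t < flight_time \<xi> (Suc n))"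

definition flight_process :: "(nat \<Rightarrow> real) \<Rightarrow> (nat \<Rightarrow> R3) \<Rightarrow> real \<Rightarrow> R3" where
  "flight_process \<xi> u t =
     (let n = flight_index \<xi> t
      in (\<Sum>j=1..n. \<xi> j *\<^sub>R u j) + (t - flight_time \<xi> n) *\<^sub>R u (Suc n))"


text \<open>
  Motion among fixed spherical scatterers of radius \<open>r\<close>.  A scatterer is given by its centre;
  \<open>None\<close> plays the role of the point at infinity, that is, of an absent scatterer.
  Starting at \<open>x\<close> with velocity \<open>v\<close>, \<open>(s, c) \<in> impacts r S x v\<close> says that the free
  flight is at time \<open>s\<close> on the sphere around \<open>c\<close> and moving strictly into it.  Asking for
  an inward velocity ignores the contact with a scatterer that has just been left, and also
  tangential contacts, whose reflection is the identity.
\<close>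

definition impacts :: "real \<Rightarrow> R3 option set \<Rightarrow> R3 \<Rightarrow> R3 \<Rightarrow> (real \<times> R3) set" where
  "impacts r S x v =
     {(s, c). 0 \<le> s \<and> Some c \<in> S \<and> norm (x + s *\<^sub>R v - c) = r \<and> (x + s *\<^sub>R v - c) \<bullet> v < 0}"

definition impact_time :: "real \<Rightarrow> R3 option set \<Rightarrow> R3 \<Rightarrow> R3 \<Rightarrow> ereal" where
  "impact_time r S x v = (INF (s, c) \<in> impacts r S x v. ereal s)"

definition impact_centre :: "real \<Rightarrow> R3 option set \<Rightarrow> R3 \<Rightarrow> R3 \<Rightarrow> R3" where
  "impact_centre r S x v =
     (SOME c. (real_of_ereal (impact_time r S x v), c) \<in> impacts r S x v)"

definition elastic_reflection :: "R3 \<Rightarrow> R3 \<Rightarrow> R3" where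
  "elastic_reflection n v = v - (2 * (v \<bullet> n)) *\<^sub>R n"

text \<open>
  Time, position and outgoing velocity of the \<open>k\<close>-th collision, starting at time \<open>0\<close> in
  \<open>x\<close> with velocity \<open>v\<close> (this start counts as number \<open>0\<close>).  The time is \<open>\<infinity>\<close> if there
  is no such collision, and then position and velocity are irrelevant.
\<close>

primrec collision ::
  "real \<Rightarrow> R3 option set \<Rightarrow> R3 \<Rightarrow> R3 \<Rightarrow> nat \<Rightarrow> ereal \<times> R3 \<times> R3" where
  "collision r S x v 0 = (0, x, v)"
| "collision r S x v (Suc k) =
     (let (t, y, w) = collision r S x v k;
          s = impact_time r S y w;
          y' = y + real_of_ereal s *\<^sub>R w
      in (t + s, y', elastic_reflection (sgn (y' - impact_centre r S y w)) w))"

definition collision_time :: "real \<Rightarrow> R3 option set \<Rightarrow> R3 \<Rightarrow> R3 \<Rightarrow> nat \<Rightarrow> ereal" where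
  "collision_time r S x v k = fst (collision r S x v k)"

definition lorentz_position :: "real \<Rightarrow> R3 option set \<Rightarrow> R3 \<Rightarrow> R3 \<Rightarrow> real \<Rightarrow> R3" where
  "lorentz_position r S x v t =
     (let k = (THE k. collision_time r S x v k \<le> ereal t \<and>
                      ereal t < collision_time r S x v (Suc k));
          (t\<^sub>k, y, w) = collision r S x v k
      in y + (t - real_of_ereal t\<^sub>k) *\<^sub>R w)"

text \<open>The left limit at time \<open>t > 0\<close> of the velocity.\<close>

definition lorentz_velocity_left :: "real \<Rightarrow> R3 option set \<Rightarrow> R3 \<Rightarrow> R3 \<Rightarrow> real \<Rightarrow> R3" where
  "lorentz_velocity_left r S x v t =
     (let k = (THE k. collision_time r S x v k < ereal t \<and>
                      ereal t \<le> collision_time r S x v (Suc k));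
          (t\<^sub>k, y, w) = collision r S x v k
      in w)"


text \<open>
  State of the exploration at time \<open>\<tau>\<^sub>n = flight_time \<xi> n\<close>: the trajectory before
  \<open>\<tau>\<^sub>n\<close> (its values at later times are irrelevant), the position at \<open>\<tau>\<^sub>n\<close>, the velocity
  right after \<open>\<tau>\<^sub>n\<close>, and the scatterers found so far.
\<close>

primrec exploration ::
  "real \<Rightarrow> (nat \<Rightarrow> real) \<Rightarrow> (nat \<Rightarrow> R3) \<Rightarrow> nat \<Rightarrow>
     (real \<Rightarrow> R3) \<times> R3 \<times> R3 \<times> R3 option set" where
  "exploration r \<xi> u 0 = (\<lambda>_. 0, 0, u 1, {Some (r *\<^sub>R sgn (u 0 - u 1))})"
| "exploration r \<xi> u (Suc n) =
     (let (X, x, v, S) = exploration r \<xi> u n;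
          X' = (\<lambda>t. if t < flight_time \<xi> n then X t
                    else lorentz_position r S x v (t - flight_time \<xi> n));
          x' = lorentz_position r S x v (\<xi> (Suc n));
          w = lorentz_velocity_left r S x v (\<xi> (Suc n));
          c = x' + r *\<^sub>R sgn (w - u (n + 2));
          d = (INF s \<in> {0..<flight_time \<xi> (Suc n)}. norm (X' s - c))
      in if d < r then (X', x', w, insert None S)
         else (X', x', u (n + 2), insert (Some c) S))"

definition lorentz_process :: "real \<Rightarrow> (nat \<Rightarrow> real) \<Rightarrow> (nat \<Rightarrow> R3) \<Rightarrow> real \<Rightarrow> R3" where
  "lorentz_process r \<xi> u t = fst (exploration r \<xi> u (Suc (flight_index \<xi> t))) t"

text \<open>
  The infimum is \<open>\<infinity>\<close> if the paths agree for all times.  Since the exploration is meaningful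
  only outside a null set, events about \<open>first_discrepancy\<close> are measured by \<^const>\<open>outer_measure_of\<close>:
  it agrees with the probability on measurable sets and with the completed probability on
  sets measurable up to null sets, whereas \<^const>\<open>measure\<close> would return \<open>0\<close> on a
  non-measurable set.
\<close>

definition first_discrepancy :: "(real \<Rightarrow> R3) \<Rightarrow> (real \<Rightarrow> R3) \<Rightarrow> ereal" where
  "first_discrepancy X Y = Inf (ereal ` {t. 0 \<le> t \<and> X t \<noteq> Y t})"

end

theory Submission
  imports Defs
begin

text \<open>
  As long as every vertex of the flight path keeps distance \<open>3 r\<close> from every segment not adjacent
  to it, no scatterer is hit again and no new scatterer is shadowed, so \<open>X\<^sup>r\<close> and \<open>Y\<close> coincide.

  A vertex and a segment separated by the steps in \<open>J\<close> are \<open>\<rho>\<close>-close only if the displacement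
  \<open>\<Sum>\<^sub>J \<xi>\<^sub>i u\<^sub>i\<close>, projected along the direction \<open>u\<^sub>j\<close> of the segment, has length at most \<open>\<rho>\<close>.
  Freezing the directions and integrating over one of the \<open>\<xi>\<^sub>i\<close> bounds the probability of this by
  \<open>O(\<rho>)\<close>; if \<open>J\<close> has at least three elements, two linear constraints can be treated separately
  and the bound is \<open>O(\<rho>\<^sup>2)\<close>. The two constraints are chosen so that only integrable singularities
  in the directions appear: the orthogonal component of \<open>u\<^sub>i\<close> relative to \<open>u\<^sub>j\<close> enters with exponent
  \<open>-1\<close>, and for the normal \<open>u\<^sub>j \<times> u\<^sub>i\<close> the better of two further steps \<open>u\<^sub>k\<close>, \<open>u\<^sub>l\<close> is used.

  Among the first \<open>K \<approx> 2 T\<close> steps there are \<open>O(K)\<close> pairs of the first kind and \<open>O(K\<^sup>2)\<close> of the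
  second, whence a bound \<open>O(K r + (K r)\<^sup>2)\<close>; transience of the walk is not needed. The event
  \<open>\<tau>\<^sub>K \<le> T\<close> is exponentially unlikely.
\<close>

subsection \<open>The exploration process along a well separated flight path\<close>

text \<open>
  Letting \<open>s\<close> range over the whole line rather than over the duration of segment \<open>j\<close> only
  enlarges the event, and makes it independent of \<open>\<xi>\<^sub>j\<close>.
\<close>

definition near :: "real \<Rightarrow> (nat \<Rightarrow> real) \<Rightarrow> (nat \<Rightarrow> R3) \<Rightarrow> nat set \<Rightarrow> nat \<Rightarrow> bool" where
  "near \<rho> \<xi> u J j \<longleftrightarrow> (\<exists>s. norm ((\<Sum>i\<in>J. \<xi> i *\<^sub>R u i) + s *\<^sub>R u j) \<le> \<rho>)"

text \<open>
  The displacement over \<open>{k+1..n}\<close> leads from vertex \<open>k\<close> to vertex \<open>n\<close>. Segment \<open>k\<close> ends in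
  vertex \<open>k\<close> (shadowing), segment \<open>n + 1\<close> starts in vertex \<open>n\<close> (recollision). For \<open>k = 0\<close> the
  first alternative has no meaning for the path, but is harmless as \<open>u\<^sub>0\<close> is a direction like the others.
\<close>

definition entangled :: "real \<Rightarrow> (nat \<Rightarrow> real) \<Rightarrow> (nat \<Rightarrow> R3) \<Rightarrow> nat \<Rightarrow> bool" where
  "entangled \<rho> \<xi> u N \<longleftrightarrow>
     (\<exists>k n. k < n \<and> n \<le> N \<and> (near \<rho> \<xi> u {k+1..n} k \<or> near \<rho> \<xi> u {k+1..n} (Suc n)))"

section \<open>Free flight up to the first collision\<close>

lemma impact_time_nonneg: "0 \<le> impact_time r S x v"
  unfolding impact_time_def impacts_def by (auto intro!: INF_greatest)

lemma collision_time_Suc: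
  "collision_time r S x v (Suc k) \<ge> collision_time r S x v k"
  unfolding collision_time_def
  by (auto simp: Let_def split_beta intro: add_increasing2 impact_time_nonneg)

lemma collision_time_0 [simp]: "collision_time r S x v 0 = 0"
  by (simp add: collision_time_def)

lemma collision_time_1 [simp]: "collision_time r S x v (Suc 0) = impact_time r S x v"
  by (simp add: collision_time_def Let_def)

lemma collision_time_ge:
  assumes "k > 0" shows "impact_time r S x v \<le> collision_time r S x v k"
proof -
  have "collision_time r S x v (Suc 0) \<le> collision_time r S x v k"
    using assms lift_Suc_mono_le[of "collision_time r S x v" "Suc 0" k] collision_time_Suc by auto
  then show ?thesis by simp
qed

text \<open>Collision 0 is the start at time 0, and collision times are nondecreasing with collision
  1 at \<open>impact_time\<close>. Before that time the index picked by \<open>THE\<close> is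
  therefore 0.\<close>

lemma lorentz_position_free:
  assumes "0 \<le> t" "ereal t < impact_time r S x v"
  shows "lorentz_position r S x v t = x + t *\<^sub>R v"
proof -
  have "(THE k. collision_time r S x v k \<le> ereal t \<and> ereal t < collision_time r S x v (Suc k)) = 0"
  proof (rule the_equality)
    fix k assume k: "collision_time r S x v k \<le> ereal t \<and> ereal t < collision_time r S x v (Suc k)"
    show "k = 0"
    proof (rule ccontr)
      assume "k \<noteq> 0"
      then show False using collision_time_ge[of k r S x v] k assms by auto
    qed
  qed (use assms in \<open>auto simp: zero_ereal_def\<close>)
  then show ?thesis by (simp add: lorentz_position_def)
qed

lemma lorentz_velocity_left_free:
  assumes "0 < t" "ereal t < impact_time r S x v"
  shows "lorentz_velocity_left r S x v t = v"
proof -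
  have "(THE k. collision_time r S x v k < ereal t \<and> ereal t \<le> collision_time r S x v (Suc k)) = 0"
  proof (rule the_equality)
    fix k assume k: "collision_time r S x v k < ereal t \<and> ereal t \<le> collision_time r S x v (Suc k)"
    show "k = 0"
    proof (rule ccontr)
      assume "k \<noteq> 0"
      then show False using collision_time_ge[of k r S x v] k assms by auto
    qed
  qed (use assms in \<open>auto simp: zero_ereal_def\<close>)
  then show ?thesis by (simp add: lorentz_velocity_left_def)
qed

text \<open>Both properties hold almost surely for all j at once, so the pathwise argument can
  assume them everywhere; the exceptional null set returns only in the final union bound.\<close>

locale flight_path =
  fixes \<xi> :: "nat \<Rightarrow> real" and u :: "nat \<Rightarrow> R3"
  assumes \<xi>_pos: "\<xi> j > 0" and norm_u [simp]: "norm (u j) = 1"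
begin

abbreviation \<tau> where "\<tau> \<equiv> flight_time \<xi>"

definition vertex :: "nat \<Rightarrow> R3" where "vertex n = (\<Sum>j=1..n. \<xi> j *\<^sub>R u j)"

lemma \<tau>_0 [simp]: "\<tau> 0 = 0" by (simp add: flight_time_def)
lemma \<tau>_Suc: "\<tau> (Suc n) = \<tau> n + \<xi> (Suc n)" by (simp add: flight_time_def)
lemma vertex_0 [simp]: "vertex 0 = 0" by (simp add: vertex_def)
lemma vertex_Suc: "vertex (Suc n) = vertex n + \<xi> (Suc n) *\<^sub>R u (Suc n)" by (simp add: vertex_def)

lemma u_self [simp]: "u j \<bullet> u j = 1"
  by (simp add: dot_square_norm)

lemma \<tau>_strict_mono: "strict_mono \<tau>"
  by (rule strict_monoI_Suc) (simp add: \<tau>_Suc \<xi>_pos)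

lemma flight_index_eq:
  assumes "\<tau> n \<le> t" "t < \<tau> (Suc n)"
  shows "flight_index \<xi> t = n"
  unfolding flight_index_def
proof (rule the_equality)
  fix m assume m: "\<tau> m \<le> t \<and> t < \<tau> (Suc m)"
  have "\<tau> m < \<tau> (Suc n)" "\<tau> n < \<tau> (Suc m)" using m assms by auto
  then show "m = n" using strict_mono_less[OF \<tau>_strict_mono] by auto
qed (use assms in auto)

lemma flight_index_exists:
  assumes "0 \<le> t" "t < \<tau> N"
  obtains n where "n < N" "\<tau> n \<le> t" "t < \<tau> (Suc n)"
proof -
  define m where "m = (LEAST m. t < \<tau> m)"
  have 1: "t < \<tau> m" and le: "m \<le> N" unfolding m_def using assms by (auto intro: LeastI Least_le)
  then obtain n where n: "m = Suc n" using assms by (cases m) auto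
  then have "\<not> t < \<tau> n" unfolding m_def using not_less_Least[of n "\<lambda>m. t < \<tau> m"] m_def by auto
  then show ?thesis using that[of n] 1 n le by auto
qed

lemma flight_process_eq:
  assumes "\<tau> n \<le> t" "t < \<tau> (Suc n)"
  shows "flight_process \<xi> u t = vertex n + (t - \<tau> n) *\<^sub>R u (Suc n)"
  using flight_index_eq[OF assms] by (simp add: flight_process_def Let_def vertex_def)

lemma vertex_diff:
  assumes "k \<le> n" shows "(\<Sum>i\<in>{k+1..n}. \<xi> i *\<^sub>R u i) = vertex n - vertex k"
  using assms by (induction rule: dec_induct) (auto simp: vertex_Suc)

text \<open>Excludes recollision: the whole line carrying segment n + 1 avoids every earlier
  vertex.\<close>

lemma forward_far:
  assumes "\<not> entangled \<rho> \<xi> u N" "k < n" "n \<le> N"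
  shows "norm (vertex n + s *\<^sub>R u (Suc n) - vertex k) > \<rho>"
proof -
  have "\<not> near \<rho> \<xi> u {k+1..n} (Suc n)" using assms by (auto simp: entangled_def)
  then have "\<rho> < norm ((vertex n - vertex k) + s *\<^sub>R u (Suc n))"
    unfolding near_def using vertex_diff[of k n] assms by (auto simp: not_le)
  then show ?thesis by (simp add: algebra_simps)
qed

text \<open>Excludes shadowing: the line carrying the segment that ends in vertex k avoids every
  later vertex.\<close>

lemma backward_far:
  assumes "\<not> entangled \<rho> \<xi> u N" "k < n" "n \<le> N"
  shows "norm (vertex n - (vertex k + s *\<^sub>R u k)) > \<rho>"
proof -
  have "\<not> near \<rho> \<xi> u {k+1..n} k" using assms by (auto simp: entangled_def)
  then have "\<rho> < norm ((vertex n - vertex k) + (-s) *\<^sub>R u k)"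
    unfolding near_def using vertex_diff[of k n] assms by (metis less_imp_le not_le)
  then show ?thesis by (simp add: algebra_simps)
qed

text \<open>The centre that the exploration proposes at vertex n as long as it follows the flight; n
  = 0 gives the initial scatterer. If the two directions coincide, \<open>sgn 0 = 0\<close> makes it
  the vertex itself, so its distance from the vertex is only bounded by r.\<close>

definition centre :: "real \<Rightarrow> nat \<Rightarrow> R3" where
  "centre r n = vertex n + r *\<^sub>R sgn (u n - u (Suc n))"

lemma norm_centre: "r > 0 \<Longrightarrow> norm (centre r n - vertex n) \<le> r"
  by (simp add: centre_def norm_sgn)

lemma no_impact:
  assumes r: "r > 0" and ne: "\<not> entangled (3 * r) \<xi> u N" and n: "n \<le> N"
    and S: "S \<subseteq> insert None ((Some \<circ> centre r) ` {..n})"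
  shows "ereal (\<xi> (Suc n)) < impact_time r S (vertex n) (u (Suc n))"
proof -
  \<comment> \<open>Both cases below are contradictory, so there are no impacts at all. The margin r
    keeps the inequality strict after passing to the infimum.\<close>
  have "ereal (\<xi> (Suc n) + r) \<le> ereal s"
    if sc: "(s, c) \<in> impacts r S (vertex n) (u (Suc n))" for s c
  proof -
    let ?y = "vertex n + s *\<^sub>R u (Suc n)"
    from sc S obtain k where s: "0 \<le> s" and k: "k \<le> n" "c = centre r k"
      and d: "norm (?y - c) = r" "(?y - c) \<bullet> u (Suc n) < 0"
      unfolding impacts_def by auto
    show ?thesis
    proof (cases "k = n")
      \<comment> \<open>The scatterer just left: the velocity points away from it or along it, so at
        no later time is the motion directed into it.\<close>
      case True
      have "(u n - u (Suc n)) \<bullet> u (Suc n) \<le> 0"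
        using norm_cauchy_schwarz[of "u n" "u (Suc n)"] by (simp add: inner_diff_left)
      then have "sgn (u n - u (Suc n)) \<bullet> u (Suc n) \<le> 0"
        by (simp add: sgn_div_norm divide_simps mult_le_0_iff)
      then have "(?y - c) \<bullet> u (Suc n) \<ge> 0"
        using s r unfolding k(2) True centre_def
        by (simp add: inner_diff_left inner_add_left mult_nonneg_nonpos order_trans[OF _ s])
      with d show ?thesis by simp
    next
      \<comment> \<open>Contact with scatterer k would bring the particle within 2 r of vertex k,
        while the line stays more than 3 r away.\<close>
      case False
      then have "norm (?y - vertex k) > 3 * r" using forward_far[OF ne _ n] k by auto
      moreover have "norm (?y - vertex k) \<le> norm (?y - c) + norm (c - vertex k)"
        by (metis diff_add_cancel norm_triangle_ineq add_diff_eq)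
      ultimately show ?thesis using d norm_centre[OF r, of k] k r by simp
    qed
  qed
  then have "ereal (\<xi> (Suc n) + r) \<le> impact_time r S (vertex n) (u (Suc n))"
    unfolding impact_time_def by (auto intro!: INF_greatest)
  then show ?thesis using r by (metis less_add_same_cancel1 less_ereal.simps(1) order_less_le_trans)
qed

text \<open>On the last segment, going back from the vertex never leads closer to the new centre; on
  earlier segments the path is more than 3 r from the vertex, hence more than 2 r from the centre.
  The directions must differ, since otherwise the centre is the vertex, which the path approaches
  arbitrarily closely.\<close>

lemma scatterer_unshadowed:
  assumes r: "r > 0" and ne: "\<not> entangled (3 * r) \<xi> u N" and n: "Suc n \<le> N"
    and s: "0 \<le> s" "s < \<tau> (Suc n)" and neq: "u (Suc n) \<noteq> u (Suc (Suc n))"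
  shows "r \<le> norm (flight_process \<xi> u s - centre r (Suc n))"
proof -
  obtain m where m: "m < Suc n" "\<tau> m \<le> s" "s < \<tau> (Suc m)" using flight_index_exists[OF s] .
  \<comment> \<open>Time left until the end of the segment, so that the position is measured back
    from the final vertex as in \<open>backward_far\<close>.\<close>
  define t where "t = \<tau> (Suc m) - s"
  have t: "t > 0" using m by (simp add: t_def)
  have p: "flight_process \<xi> u s = vertex (Suc m) - t *\<^sub>R u (Suc m)"
    using flight_process_eq[OF m(2,3)]
    by (simp add: t_def \<tau>_Suc vertex_Suc algebra_simps)
  show ?thesis
  proof (cases "m = n")
    case True
    let ?e = "sgn (u (Suc n) - u (Suc (Suc n)))"
    have e: "norm ?e = 1" using neq by (simp add: norm_sgn)
    have "(u (Suc n) - u (Suc (Suc n))) \<bullet> u (Suc n) \<ge> 0"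
      using norm_cauchy_schwarz[of "u (Suc n)" "u (Suc (Suc n))"] by (simp add: inner_diff_left inner_commute[of "u (Suc (Suc n))"])
    then have "?e \<bullet> u (Suc n) \<ge> 0"
      by (simp add: sgn_div_norm divide_simps inner_diff_left)
    then have "?e \<bullet> (flight_process \<xi> u s - centre r (Suc n)) \<le> - r"
      unfolding p centre_def True using t e
      by (simp add: inner_diff_right inner_add_right dot_square_norm)
    moreover have "- (?e \<bullet> (flight_process \<xi> u s - centre r (Suc n))) \<le> 1 * norm (flight_process \<xi> u s - centre r (Suc n))"
      using Cauchy_Schwarz_ineq2[of ?e "flight_process \<xi> u s - centre r (Suc n)"] e by auto
    ultimately show ?thesis by simp
  next
    case False
    then have "norm (vertex (Suc n) - (vertex (Suc m) + (-t) *\<^sub>R u (Suc m))) > 3 * r"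
      using backward_far[OF ne, of "Suc m" "Suc n" "-t"] m n by auto
    moreover have "norm (vertex (Suc n) - flight_process \<xi> u s)
        \<le> norm (flight_process \<xi> u s - centre r (Suc n)) + norm (centre r (Suc n) - vertex (Suc n))"
      by (metis norm_minus_commute norm_triangle_sub add.commute dist_norm dist_triangle)
    ultimately show ?thesis using norm_centre[OF r, of "Suc n"] r by (simp add: p)
  qed
qed

lemma exploration_eq:
  assumes r: "r > 0" and ne: "\<not> entangled (3 * r) \<xi> u N" and n: "n \<le> N"
  shows "\<exists>X S. exploration r \<xi> u n = (X, vertex n, u (Suc n), S) \<and>
           (\<forall>t. 0 \<le> t \<and> t < \<tau> n \<longrightarrow> X t = flight_process \<xi> u t) \<and>
           S \<subseteq> insert None ((Some \<circ> centre r) ` {..n})"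
  using n
proof (induction n)
  case 0
  show ?case by (auto simp: centre_def)
next
  case (Suc n)
  then obtain X S where IH: "exploration r \<xi> u n = (X, vertex n, u (Suc n), S)"
    "\<And>t. 0 \<le> t \<Longrightarrow> t < \<tau> n \<Longrightarrow> X t = flight_process \<xi> u t"
    "S \<subseteq> insert None ((Some \<circ> centre r) ` {..n})" by auto
  have imp: "ereal (\<xi> (Suc n)) < impact_time r S (vertex n) (u (Suc n))"
    using no_impact[OF r ne _ IH(3)] Suc.prems by auto
  \<comment> \<open>The endpoint \<open>t = \<xi> (Suc n)\<close> is included, because the
    exploration evaluates the position there to find the next vertex.\<close>
  have pos: "lorentz_position r S (vertex n) (u (Suc n)) t = vertex n + t *\<^sub>R u (Suc n)"
    if "0 \<le> t" "t \<le> \<xi> (Suc n)" for t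
    using that imp by (intro lorentz_position_free) (auto intro: le_less_trans[rotated])
  have vel: "lorentz_velocity_left r S (vertex n) (u (Suc n)) (\<xi> (Suc n)) = u (Suc n)"
    using imp \<xi>_pos by (intro lorentz_velocity_left_free) auto
  define X' where "X' t = (if t < \<tau> n then X t
       else lorentz_position r S (vertex n) (u (Suc n)) (t - \<tau> n))" for t
  have X': "X' t = flight_process \<xi> u t" if "0 \<le> t" "t < \<tau> (Suc n)" for t
  proof (cases "t < \<tau> n")
    case True then show ?thesis using IH(2) that by (simp add: X'_def)
  next
    case False
    then show ?thesis using that pos[of "t - \<tau> n"] flight_process_eq[of n t]
      by (simp add: X'_def \<tau>_Suc)
  qed
  let ?d = "INF s\<in>{0..<\<tau> (Suc n)}. norm (X' s - centre r (Suc n))"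
  have ex: "exploration r \<xi> u (Suc n) =
     (if ?d < r then (X', vertex (Suc n), u (Suc n), insert None S)
      else (X', vertex (Suc n), u (Suc (Suc n)), insert (Some (centre r (Suc n))) S))"
    using \<xi>_pos[of "Suc n"]
    by (simp add: IH(1) vel pos vertex_Suc[symmetric] X'_def[symmetric, abs_def] centre_def[of r "Suc n", symmetric])
  \<comment> \<open>A scatterer is rejected only when old and new direction coincide. Keeping the
    old velocity is then the same as taking the new one, so the coupling survives.\<close>
  have u: "u (Suc n) = u (Suc (Suc n))" if "?d < r"
  proof (rule ccontr)
    assume neq: "u (Suc n) \<noteq> u (Suc (Suc n))"
    have "r \<le> ?d"
    proof (rule cINF_greatest)
      show "{0..<\<tau> (Suc n)} \<noteq> {}"
        using strict_monoD[OF \<tau>_strict_mono, of 0 "Suc n"] by auto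
      fix s assume "s \<in> {0..<\<tau> (Suc n)}"
      then show "r \<le> norm (X' s - centre r (Suc n))"
        using scatterer_unshadowed[OF r ne Suc.prems _ _ neq, of s] X' by auto
    qed
    with that show False by simp
  qed
  have sub: "insert None S \<subseteq> insert None ((Some \<circ> centre r) ` {..Suc n})"
     "insert (Some (centre r (Suc n))) S \<subseteq> insert None ((Some \<circ> centre r) ` {..Suc n})"
    using IH(3) unfolding atMost_Suc image_insert o_apply by blast+
  show ?case
    by (cases "?d < r") (use ex u sub X' in auto)
qed

lemma first_discrepancy_ge:
  assumes r: "r > 0" and ne: "\<not> entangled (3 * r) \<xi> u N"
  shows "ereal (\<tau> N) \<le> first_discrepancy (lorentz_process r \<xi> u) (flight_process \<xi> u)"
proof -
  have "lorentz_process r \<xi> u t = flight_process \<xi> u t" if t: "0 \<le> t" "t < \<tau> N" for t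
  proof -
    obtain n where n: "n < N" "\<tau> n \<le> t" "t < \<tau> (Suc n)" using flight_index_exists[OF t] .
    \<comment> \<open>On segment n the process is read off stage \<open>Suc n\<close> of the
      exploration, and n < N makes that stage available.\<close>
    then show ?thesis
      using exploration_eq[OF r ne, of "Suc n"] t flight_index_eq[OF n(2,3)]
      by (auto simp: lorentz_process_def simp del: exploration.simps)
  qed
  then show ?thesis
    unfolding first_discrepancy_def by (intro Inf_greatest) (auto simp: not_less[symmetric])
qed

end

subsection \<open>Integrals over the sphere\<close>

text \<open>Taken in \<open>ennreal\<close> so that the reciprocal of 0 is infinite: upper bounds
  with this factor stay true in degenerate configurations.\<close>

definition inv_norm :: "R3 \<Rightarrow> ennreal" where
  "inv_norm x = inverse (ennreal (norm x))"

definition inv_sqrt :: "real \<Rightarrow> ennreal" where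
  "inv_sqrt x = inverse (ennreal (sqrt \<bar>x\<bar>))"

definition transverse :: "R3 \<Rightarrow> R3 \<Rightarrow> R3" where
  "transverse e x = x - (x \<bullet> e) *\<^sub>R e"

lemma measurable_inv_norm [measurable]: "inv_norm \<in> borel_measurable borel"
  unfolding inv_norm_def by measurable

lemma measurable_inv_sqrt [measurable]: "inv_sqrt \<in> borel_measurable borel"
  unfolding inv_sqrt_def by measurable

lemma borel_measurable_orthogonal:
  fixes f :: "R3 \<Rightarrow> R3"
  assumes f: "orthogonal_transformation f"
  shows "f \<in> borel_measurable borel"
proof -
  have "bounded_linear f"
    using f orthogonal_transformation_linear linear_conv_bounded_linear by blast
  then show ?thesis by (intro borel_measurable_continuous_onI linear_continuous_on)
qed

lemma inverse_ennreal_antimono: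
  "a \<le> b \<Longrightarrow> inverse (ennreal b) \<le> inverse (ennreal a)"
  by (cases "a > 0") (auto simp: inverse_ennreal ennreal_neg le_imp_inverse_le ennreal_leI)

lemma inv_sqrt_antimono: "\<bar>x\<bar> \<le> \<bar>y\<bar> \<Longrightarrow> inv_sqrt y \<le> inv_sqrt x"
  unfolding inv_sqrt_def by (intro inverse_ennreal_antimono) simp

text \<open>Boxes determine \<open>lborel\<close>, and the preimage of a box is its image under the
  inverse orthogonal map, which preserves Lebesgue measure.\<close>

lemma distr_lborel_orthogonal:
  fixes f :: "R3 \<Rightarrow> R3"
  assumes f: "orthogonal_transformation f"
  shows "distr lborel borel f = lborel"
proof (rule lborel_eqI[symmetric])
  note [measurable] = borel_measurable_orthogonal[OF f]
  fix l u :: R3 assume le: "\<And>b. b \<in> Basis \<Longrightarrow> l \<bullet> b \<le> u \<bullet> b"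
  let ?g = "inv f"
  have g: "orthogonal_transformation ?g" by (rule orthogonal_transformation_inv[OF f])
  have vim: "f -` box l u = ?g ` box l u"
    by (rule bij_vimage_eq_inv_image[OF orthogonal_transformation_bij[OF f]])
  have m: "?g ` box l u \<in> lmeasurable" by (rule measurable_orthogonal_image[OF g lmeasurable_box])
  have b: "?g ` box l u \<in> sets borel"
    using measurable_sets[of f borel borel "box l u"] by (simp add: vim)
  have "emeasure (distr lborel borel f) (box l u) = emeasure lebesgue (?g ` box l u)"
    using b by (simp add: emeasure_distr vim)
  also have "\<dots> = ennreal (measure lebesgue (?g ` box l u))"
    using fmeasurableD2[OF m] by (simp add: emeasure_eq_ennreal_measure)
  also have "measure lebesgue (?g ` box l u) = measure lebesgue (box l u)"
    by (rule measure_orthogonal_image[OF g lmeasurable_box])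
  also have "ennreal \<dots> = (\<Prod>b\<in>Basis. (u - l) \<bullet> b)"
    using le by (simp add: measure_lborel_box_eq)
  finally show "emeasure (distr lborel borel f) (box l u) = (\<Prod>b\<in>Basis. (u - l) \<bullet> b)" .
qed simp

lemma nn_integral_uniform_sphere:
  assumes [measurable]: "f \<in> borel_measurable borel"
  shows "(\<integral>\<^sup>+x. f x \<partial>uniform_sphere) =
     (\<integral>\<^sup>+x. f (sgn x) * indicator (ball 0 1) x \<partial>lborel) / emeasure lborel (ball (0::R3) 1)"
  by (simp add: uniform_sphere_def nn_integral_distr nn_integral_uniform_measure)

text \<open>Lebesgue measure and the unit ball are both invariant under f, and f commutes with
  \<open>sgn\<close>.\<close>

lemma nn_integral_uniform_sphere_orthogonal:
  assumes f: "orthogonal_transformation f" and [measurable]: "g \<in> borel_measurable borel"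
  shows "(\<integral>\<^sup>+x. g (f x) \<partial>uniform_sphere) = (\<integral>\<^sup>+x. g x \<partial>uniform_sphere)"
proof -
  note [measurable] = borel_measurable_orthogonal[OF f]
  have n: "norm (f x) = norm x" for x by (rule orthogonal_transformation_norm[OF f])
  have s: "f (sgn x) = sgn (f x)" for x
    by (simp add: sgn_div_norm n orthogonal_transformation_scaleR[OF f])
  have "(\<integral>\<^sup>+x. g (sgn x) * indicator (ball 0 1) x \<partial>lborel)
     = (\<integral>\<^sup>+x. g (sgn x) * indicator (ball 0 1) x \<partial>distr lborel borel f)"
    by (simp add: distr_lborel_orthogonal[OF f])
  also have "\<dots> = (\<integral>\<^sup>+x. g (f (sgn x)) * indicator (ball 0 1) x \<partial>lborel)"
    by (subst nn_integral_distr) (auto simp: s n indicator_def intro!: nn_integral_cong)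
  finally show ?thesis by (simp add: nn_integral_uniform_sphere)
qed

lemma emeasure_unit_ball: "emeasure lborel (ball (0::R3) 1) = ennreal (4 / 3 * pi)"
  using emeasure_ball[of 1 "0::R3"] by (simp add: unit_ball_vol_3)

lemma sets_uniform_sphere [measurable_cong, simp]: "sets uniform_sphere = sets borel"
  by (simp add: uniform_sphere_def)

lemma AE_uniform_sphere_norm: "AE x in uniform_sphere. norm x = 1"
proof -
  have "AE x in uniform_measure lborel (ball (0::R3) 1). x \<noteq> 0"
    using AE_lborel_singleton[of "0::R3"] by (intro AE_uniform_measureI) auto
  then have "AE x in uniform_measure lborel (ball (0::R3) 1). norm (sgn x) = 1"
    by (rule AE_mp) (simp add: norm_sgn)
  then show ?thesis
    unfolding uniform_sphere_def by (subst AE_distr_iff) simp_all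
qed

lemma nn_integral_inv_sqrt_finite:
  "(\<integral>\<^sup>+x. inv_sqrt x * indicator {-1..1} x \<partial>lborel) < \<infinity>"
proof -
  define f where "f x = ennreal (x powr (-1/2)) * indicator {0..1} x" for x :: real
  have [measurable]: "f \<in> borel_measurable borel" unfolding f_def by measurable
  have "((\<lambda>x. x powr (-1/2)) has_integral (1 powr (-1/2 + 1) / (-1/2 + 1))) {0..1::real}"
    by (rule has_integral_powr_from_0) auto
  then have f: "(\<integral>\<^sup>+x. f x \<partial>lborel) = 2"
    unfolding f_def by (subst nn_integral_has_integral_lebesgue') auto
  have f': "(\<integral>\<^sup>+x. f (-x) \<partial>lborel) = 2"
    using nn_integral_real_affine[of f "-1" 0] f by simp
  have "(\<integral>\<^sup>+x. inv_sqrt x * indicator {-1..1} x \<partial>lborel) \<le> (\<integral>\<^sup>+x. f x + f (-x) \<partial>lborel)"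
  \<comment> \<open>The comparison fails at 0, where \<open>inv_sqrt\<close> is infinite but
    \<open>0 powr (-1/2)\<close> is 0.\<close>
  proof (rule nn_integral_mono_AE, rule AE_mp[OF AE_lborel_singleton[of 0]], rule AE_I2, rule impI)
    fix x :: real assume x: "x \<noteq> 0"
    have "inv_sqrt x = ennreal (\<bar>x\<bar> powr (-1/2))"
    proof -
      have "inverse (ennreal (sqrt \<bar>x\<bar>)) = ennreal (inverse (sqrt \<bar>x\<bar>))"
        using x by (intro inverse_ennreal) auto
      moreover have "\<bar>x\<bar> powr (-1/2) = inverse (sqrt \<bar>x\<bar>)"
        using powr_minus[of "\<bar>x\<bar>" "1/2"] powr_half_sqrt[of "\<bar>x\<bar>"] by simp
      ultimately show ?thesis by (simp only: inv_sqrt_def)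
    qed
    then show "inv_sqrt x * indicator {-1..1} x \<le> f x + f (-x)"
      using x by (cases "x > 0") (auto simp: f_def indicator_def)
  qed
  also have "\<dots> = 4" by (subst nn_integral_add) (auto simp: f f')
  finally show ?thesis by (auto simp: le_less_trans)
qed

lemma prod_3: "prod f (UNIV :: 3 set) = f 1 * f 2 * f 3"
  unfolding UNIV_3 by (simp add: ac_simps)

lemma nn_integral_cube_finite:
  fixes f :: "3 \<Rightarrow> real \<Rightarrow> ennreal"
  assumes [measurable]: "\<And>i. f i \<in> borel_measurable borel"
    and fin: "\<And>i. (\<integral>\<^sup>+x. f i x * indicator {-1..1} x \<partial>lborel) < \<infinity>"
  shows "(\<integral>\<^sup>+x. (\<Prod>i\<in>UNIV. f i (x $ i)) * indicator (ball 0 1) x \<partial>lborel) < \<infinity>"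
proof -
  \<comment> \<open>The product formula for \<open>lborel\<close> runs over basis vectors;
    \<open>axis_index\<close> turns them back into coordinates.\<close>
  define g :: "R3 \<Rightarrow> real \<Rightarrow> ennreal" where
    "g b x = f (axis_index b) x * indicator {-1..1} x" for b x
  have [measurable]: "g b \<in> borel_measurable borel" for b unfolding g_def by measurable
  have B: "(\<Prod>b\<in>Basis. h b) = (\<Prod>i\<in>UNIV. h (axis i 1))" for h :: "R3 \<Rightarrow> ennreal"
  proof -
    have B: "(Basis :: R3 set) = range (\<lambda>i. axis i 1)" by (auto simp: Basis_vec_def)
    have "inj (\<lambda>i. axis i 1 :: R3)" by (simp add: inj_on_def axis_eq_axis)
    then show ?thesis unfolding B by (subst prod.reindex) simp_all
  qed
  have ai: "axis_index (axis i 1 :: R3) = i" for i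
    by (simp add: axis_index_axis)
  have "(\<integral>\<^sup>+x. (\<Prod>i\<in>UNIV. f i (x $ i)) * indicator (ball 0 1) x \<partial>lborel)
      \<le> (\<integral>\<^sup>+x. (\<Prod>b\<in>Basis. g b (x \<bullet> b)) \<partial>(lborel :: R3 measure))"
  proof (intro nn_integral_mono)
    fix x :: R3
    have "\<bar>x $ i\<bar> \<le> 1" if "x \<in> ball 0 1" for i
      using that component_le_norm_cart[of x i] by auto
    then show "(\<Prod>i\<in>UNIV. f i (x $ i)) * indicator (ball 0 1) x \<le> (\<Prod>b\<in>Basis. g b (x \<bullet> b))"
      unfolding B by (auto simp: g_def ai inner_axis indicator_def abs_le_iff intro!: prod_mono)
  qed
  also have "\<dots> = (\<Prod>b\<in>Basis. \<integral>\<^sup>+x. g b x \<partial>lborel)"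
    by (rule nn_integral_lborel_prod) auto
  also have "\<dots> < \<infinity>"
    using fin by (auto simp: g_def less_top[symmetric] ennreal_prod_eq_top)
  finally show ?thesis .
qed

text \<open>
  Passing from the ball to the cube makes the integral factorise, so no polar coordinates are needed.
\<close>

lemma finite_uniform_sphere_bound:
  fixes f :: "3 \<Rightarrow> real \<Rightarrow> ennreal"
  assumes [measurable]: "g \<in> borel_measurable borel"
    and "\<And>i. f i \<in> borel_measurable borel"
    and "\<And>i. (\<integral>\<^sup>+x. f i x * indicator {-1..1} x \<partial>lborel) < \<infinity>"
    and le: "\<And>x. x \<noteq> 0 \<Longrightarrow> norm x < 1 \<Longrightarrow> g (sgn x) \<le> (\<Prod>i\<in>UNIV. f i (x $ i))"
  shows "(\<integral>\<^sup>+x. g x \<partial>uniform_sphere) < \<infinity>"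
proof -
  have "(\<integral>\<^sup>+x. g (sgn x) * indicator (ball 0 1) x \<partial>lborel) 
      \<le> (\<integral>\<^sup>+x. (\<Prod>i\<in>UNIV. f i (x $ i)) * indicator (ball 0 1) x \<partial>lborel)"
  proof (rule nn_integral_mono_AE, rule AE_mp[OF AE_lborel_singleton[of 0]], rule AE_I2, rule impI)
    fix x :: R3 assume "x \<noteq> 0"
    then show "g (sgn x) * indicator (ball 0 1) x \<le> (\<Prod>i\<in>UNIV. f i (x $ i)) * indicator (ball 0 1) x"
      using le[of x] by (cases "norm x < 1") simp_all
  qed
  also have "\<dots> < \<infinity>" by (rule nn_integral_cube_finite) fact+
  finally have "(\<integral>\<^sup>+x. g (sgn x) * indicator (ball 0 1) x \<partial>lborel) \<noteq> \<infinity>" by (rule less_imp_neq)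
  moreover have "emeasure lborel (ball (0::R3) 1) \<noteq> 0"
    unfolding emeasure_unit_ball using pi_gt_zero by simp
  ultimately have "(\<integral>\<^sup>+x. g x \<partial>uniform_sphere) \<noteq> \<infinity>"
    unfolding nn_integral_uniform_sphere[OF assms(1)] infinity_ennreal_def ennreal_divide_eq_top_iff
    by blast
  then show ?thesis unfolding infinity_ennreal_def less_top .
qed

text \<open>In the ball, passing from x to \<open>sgn x\<close> only enlarges the quantities that
  are inverted. What remains is dominated by \<open>inv_sqrt (x $ 1)\<close> in the first case and
  by \<open>inv_sqrt (x $ 2) * inv_sqrt (x $ 3)\<close> in the second, which are products of
  integrable functions of one coordinate.\<close>

lemma axis_sphere_bounds:
  defines "e \<equiv> axis 1 1 :: R3"
  shows "(\<integral>\<^sup>+x. inv_sqrt (x \<bullet> e) \<partial>uniform_sphere) < \<infinity>"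
    and "(\<integral>\<^sup>+x. inv_norm (transverse e x) \<partial>uniform_sphere) < \<infinity>"
proof -
  have xe: "x \<bullet> e = x $ 1" for x by (simp add: e_def inner_axis)
  have one: "(\<integral>\<^sup>+x. 1 * indicator {-1..1::real} x \<partial>lborel) < (\<infinity> :: ennreal)" by simp
  show "(\<integral>\<^sup>+x. inv_sqrt (x \<bullet> e) \<partial>uniform_sphere) < \<infinity>"
  proof (rule finite_uniform_sphere_bound[where f="\<lambda>i. if i = 1 then inv_sqrt else (\<lambda>_. 1)"])
    fix x :: R3 assume x: "x \<noteq> 0" "norm x < 1"
    have "\<bar>x $ 1\<bar> \<le> \<bar>x $ 1\<bar> / norm x" using x by (simp add: divide_simps mult_left_le)
    also have "\<dots> = \<bar>sgn x \<bullet> e\<bar>" using x by (simp add: xe sgn_div_norm abs_mult divide_inverse mult.commute)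
    finally have "inv_sqrt (sgn x \<bullet> e) \<le> inv_sqrt (x $ 1)" by (rule inv_sqrt_antimono)
    then show "inv_sqrt (sgn x \<bullet> e) \<le> (\<Prod>i\<in>UNIV. (if i = 1 then inv_sqrt else (\<lambda>_. 1)) (x $ i))"
      by (simp add: prod_3)
  qed (use one nn_integral_inv_sqrt_finite in auto)
  show "(\<integral>\<^sup>+x. inv_norm (transverse e x) \<partial>uniform_sphere) < \<infinity>"
  proof (rule finite_uniform_sphere_bound[where f="\<lambda>i. if i = 1 then (\<lambda>_. 1) else inv_sqrt"])
    show "(\<lambda>x. inv_norm (transverse e x)) \<in> borel_measurable borel" unfolding transverse_def by measurable
    fix x :: R3 assume x: "x \<noteq> 0" "norm x < 1"
    have t: "(norm (transverse e x))\<^sup>2 = (x $ 2)\<^sup>2 + (x $ 3)\<^sup>2"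
    proof -
      have "transverse e x $ 1 = 0" "transverse e x $ 2 = x $ 2" "transverse e x $ 3 = x $ 3"
        unfolding transverse_def xe by (simp_all add: e_def axis_def)
      then show ?thesis
        unfolding power2_norm_eq_inner inner_vec_def sum_3 by (simp add: power2_eq_square)
    qed
    \<comment> \<open>The sum of two squares dominates the product, which splits the norm of the
      orthogonal part into one factor per coordinate.\<close>
    have "0 \<le> (\<bar>x $ 2\<bar> - \<bar>x $ 3\<bar>)\<^sup>2" by simp
    then have "\<bar>x $ 2\<bar> * \<bar>x $ 3\<bar> \<le> (norm (transverse e x))\<^sup>2"
      unfolding t power2_diff power2_abs
      using mult_nonneg_nonneg[of "\<bar>x $ 2\<bar>" "\<bar>x $ 3\<bar>"] by linarith
    then have "sqrt \<bar>x $ 2\<bar> * sqrt \<bar>x $ 3\<bar> \<le> norm (transverse e x)"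
      by (simp add: real_sqrt_mult[symmetric] real_le_lsqrt)
    also have "transverse e x = norm x *\<^sub>R transverse e (sgn x)"
      using x by (simp add: transverse_def sgn_div_norm algebra_simps)
    then have "norm (transverse e x) \<le> norm (transverse e (sgn x))"
      using x by (simp add: mult_left_le_one_le)
    finally have le: "sqrt \<bar>x $ 2\<bar> * sqrt \<bar>x $ 3\<bar> \<le> norm (transverse e (sgn x))" .
    show "inv_norm (transverse e (sgn x)) \<le> (\<Prod>i\<in>UNIV. (if i = 1 then (\<lambda>_. 1) else inv_sqrt) (x $ i))"
    proof (cases "x $ 2 = 0 \<or> x $ 3 = 0")
      case True
      then show ?thesis by (auto simp: prod_3 inv_sqrt_def ennreal_mult_eq_top_iff top_unique)
    next
      case False
      then have "inv_sqrt (x $ 2) * inv_sqrt (x $ 3) = inverse (ennreal (sqrt \<bar>x $ 2\<bar> * sqrt \<bar>x $ 3\<bar>))"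
        by (simp add: inv_sqrt_def inverse_ennreal ennreal_mult'[symmetric])
      then show ?thesis
        using le by (simp add: prod_3 inv_norm_def inverse_ennreal_antimono ennreal_leI)
    qed
  qed (use one nn_integral_inv_sqrt_finite in auto)
qed

text \<open>Some orthogonal map carries the first axis to e, so both integrals are the same for
  every unit vector e.\<close>

lemma uniform_sphere_bounds:
  obtains C :: real where "C > 0"
    "\<And>e. norm e = 1 \<Longrightarrow> (\<integral>\<^sup>+x. inv_sqrt (x \<bullet> e) \<partial>uniform_sphere) \<le> ennreal C"
    "\<And>e. norm e = 1 \<Longrightarrow> (\<integral>\<^sup>+x. inv_norm (transverse e x) \<partial>uniform_sphere) \<le> ennreal C"
proof -
  let ?e = "axis 1 1 :: R3"
  obtain c d where c: "(\<integral>\<^sup>+x. inv_sqrt (x \<bullet> ?e) \<partial>uniform_sphere) = ennreal c" "0 \<le> c"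
    and d: "(\<integral>\<^sup>+x. inv_norm (transverse ?e x) \<partial>uniform_sphere) = ennreal d" "0 \<le> d"
    using axis_sphere_bounds unfolding infinity_ennreal_def by (metis less_top_ennreal)
  have rot: "(\<integral>\<^sup>+x. inv_sqrt (x \<bullet> e) \<partial>uniform_sphere) = ennreal c \<and>
        (\<integral>\<^sup>+x. inv_norm (transverse e x) \<partial>uniform_sphere) = ennreal d"
    if e: "norm e = 1" for e
  proof -
    obtain f where f: "orthogonal_transformation f" "f ?e = e"
      using orthogonal_transformation_exists_1[of ?e e] e by auto
    have inner: "f x \<bullet> f y = x \<bullet> y" for x y
      using f(1) by (simp add: orthogonal_transformation_def)
    have "transverse e (f x) = f (transverse ?e x)" for x
      unfolding transverse_def f(2)[symmetric] inner
      by (simp add: linear_diff linear_cmul orthogonal_transformation_linear[OF f(1)])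
    then have t: "inv_norm (transverse e (f x)) = inv_norm (transverse ?e x)" for x
      by (simp add: inv_norm_def orthogonal_transformation_norm[OF f(1)])
    have "(\<integral>\<^sup>+x. inv_sqrt (f x \<bullet> e) \<partial>uniform_sphere) = (\<integral>\<^sup>+x. inv_sqrt (x \<bullet> e) \<partial>uniform_sphere)"
      by (rule nn_integral_uniform_sphere_orthogonal[OF f(1), of "\<lambda>x. inv_sqrt (x \<bullet> e)"]) measurable
    moreover have "(\<integral>\<^sup>+x. inv_norm (transverse e (f x)) \<partial>uniform_sphere) = (\<integral>\<^sup>+x. inv_norm (transverse e x) \<partial>uniform_sphere)"
      by (rule nn_integral_uniform_sphere_orthogonal[OF f(1), of "\<lambda>x. inv_norm (transverse e x)"])
        (unfold transverse_def, measurable)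
    ultimately show ?thesis unfolding t using c d inner[of _ ?e] f(2) by simp
  qed
  show ?thesis
    \<comment> \<open>Dominates both integrals and is strictly positive.\<close>
    by (rule that[of "1 + c + d"]) (use rot c d in \<open>auto intro!: ennreal_leI\<close>)
qed

subsection \<open>Resampling a single variable\<close>

abbreviation exp_law :: "real measure" where
  "exp_law \<equiv> density lborel (\<lambda>x. ennreal (exponential_density 1 x))"

lemma nn_integral_exp_law_le:
  assumes [measurable]: "f \<in> borel_measurable borel"
  shows "(\<integral>\<^sup>+x. f x \<partial>exp_law) \<le> (\<integral>\<^sup>+x. f x \<partial>lborel)"
proof -
  have "ennreal (exponential_density 1 x) * f x \<le> 1 * f x" for x
    by (intro mult_right_mono) (auto simp: exponential_density_def ennreal_le_1)
  then show ?thesis by (simp add: nn_integral_density nn_integral_mono)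
qed

lemma borel_measurable_fst: "fst \<in> borel_measurable (borel :: (real \<times> R3) measure)"
  and borel_measurable_snd: "snd \<in> borel_measurable (borel :: (real \<times> R3) measure)"
  by (simp_all add: borel_prod[symmetric])

lemma indicator_leI:
  "(x \<in> A \<Longrightarrow> y \<in> B) \<Longrightarrow> (indicator A x :: ennreal) \<le> indicator B y"
  by (auto simp: indicator_def)

text \<open>The exponential density is at most 1 and the set is an interval of length
  \<open>2 * \<rho> / \<bar>c\<bar>\<close>. For c = 0 the right-hand side is infinite.\<close>

lemma exp_law_interval:
  assumes "\<rho> > 0"
  shows "(\<integral>\<^sup>+x. indicator {x. \<bar>x * c + d\<bar> \<le> \<rho>} x \<partial>exp_law) \<le> ennreal (2 * \<rho>) * inverse (ennreal \<bar>c\<bar>)"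
proof (cases "c = 0")
  case True
  then show ?thesis using assms by (simp add: ennreal_mult_top)
next
  case False
  have "(\<integral>\<^sup>+x. indicator {x. \<bar>x * c + d\<bar> \<le> \<rho>} x \<partial>exp_law) 
     \<le> (\<integral>\<^sup>+x. indicator {x. \<bar>x * c + d\<bar> \<le> \<rho>} x \<partial>lborel)"
    by (rule nn_integral_exp_law_le) measurable
  also have "\<dots> \<le> (\<integral>\<^sup>+x. indicator {- d / c - \<rho> / \<bar>c\<bar> .. - d / c + \<rho> / \<bar>c\<bar>} x \<partial>lborel)"
  proof (rule nn_integral_mono, rule indicator_leI)
    fix x assume "x \<in> {x. \<bar>x * c + d\<bar> \<le> \<rho>}"
    then have "\<bar>x * c + d\<bar> \<le> \<rho>" by simp
    then have "\<bar>x * c + d\<bar> / \<bar>c\<bar> \<le> \<rho> / \<bar>c\<bar>" by (intro divide_right_mono) auto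
    also have "\<bar>x * c + d\<bar> / \<bar>c\<bar> = \<bar>x + d / c\<bar>"
      using False by (simp add: abs_divide[symmetric] add_divide_distrib)
    finally show "x \<in> {- d / c - \<rho> / \<bar>c\<bar> .. - d / c + \<rho> / \<bar>c\<bar>}" by simp linarith
  qed
  also have "\<dots> = ennreal (2 * \<rho> * inverse \<bar>c\<bar>)"
    using assms by (simp add: divide_inverse)
  also have "\<dots> = ennreal (2 * \<rho>) * inverse (ennreal \<bar>c\<bar>)"
    using assms False by (simp add: ennreal_mult' inverse_ennreal)
  finally show ?thesis .
qed

text \<open>Laplace transform of the exponential law at 1, the factor per step in the tail bound for
  the flight time.\<close>

lemma nn_integral_exp_law_exp: "(\<integral>\<^sup>+x. ennreal (exp (- x)) \<partial>exp_law) = ennreal (1/2)"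
proof -
  have "(\<integral>\<^sup>+x. ennreal (exp (- x)) \<partial>exp_law) = (\<integral>\<^sup>+x. ennreal (exp (-2 * x)) * indicator {0..} x \<partial>lborel)"
    by (subst nn_integral_density, simp, simp, intro nn_integral_cong)
       (auto simp: exponential_density_def indicator_def ennreal_mult'[symmetric] exp_add[symmetric])
  also have "\<dots> = ennreal (0 - (- exp (-2 * 0) / 2))"
  proof (rule nn_integral_FTC_atLeast)
    show "((\<lambda>x::real. - exp (-2 * x) / 2) \<longlongrightarrow> 0) at_top"
    proof -
      have "filterlim (\<lambda>x::real. 2 * x) at_top at_top"
        by (rule filterlim_tendsto_pos_mult_at_top[OF tendsto_const _ filterlim_ident]) simp
      then have "filterlim (\<lambda>x::real. -2 * x) at_bot at_top"
        by (simp add: filterlim_uminus_at_bot)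
      then have "((\<lambda>x::real. exp (-2 * x)) \<longlongrightarrow> 0) at_top"
        by (rule filterlim_compose[OF exp_at_bot])
      then have "((\<lambda>x::real. - exp (-2 * x) / 2) \<longlongrightarrow> - 0 / 2) at_top"
        by (intro tendsto_intros) auto
      then show ?thesis by simp
    qed
  qed (auto intro!: derivative_eq_intros)
  finally show ?thesis by simp
qed

abbreviation path_space :: "((nat \<Rightarrow> real) \<times> (nat \<Rightarrow> R3)) measure" where
  "path_space \<equiv> PiM UNIV (\<lambda>_. borel) \<Otimes>\<^sub>M PiM UNIV (\<lambda>_. borel)"

locale flight = prob_space M for M :: "'a measure" +
  fixes \<xi> :: "nat \<Rightarrow> 'a \<Rightarrow> real" and u :: "nat \<Rightarrow> 'a \<Rightarrow> R3"
  assumes flight: "flight_variables M \<xi> u"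
begin

lemma \<xi>_meas [measurable]: "\<xi> j \<in> borel_measurable M"
  and u_meas [measurable]: "u j \<in> borel_measurable M"
  and distr_u: "distr M borel (u j) = uniform_sphere"
  and distr_\<xi>: "distr M lborel (\<xi> j) = exp_law"
  using flight by (auto simp: flight_variables_def distributed_def)

text \<open>
  Independence of an indexed family requires a common value type, hence the embedding of both
  kinds of variables into pairs.
\<close>

definition W :: "nat + nat \<Rightarrow> 'a \<Rightarrow> real \<times> R3" where
  "W i \<omega> = (case i of Inl j \<Rightarrow> (\<xi> j \<omega>, 0) | Inr j \<Rightarrow> (0, u j \<omega>))"

lemma W_meas [measurable]: "W i \<in> borel_measurable M"
  by (cases i) (auto simp: W_def[abs_def] borel_prod[symmetric])

text \<open>Every event generated by \<open>W i\<close> is already generated by the variable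
  embedded in it, and independence passes to smaller families of events.\<close>

lemma indep_W: "indep_vars (\<lambda>_. borel) W UNIV"
  unfolding indep_vars_def2
proof safe
  let ?F = "\<lambda>i. case i of
               Inl j \<Rightarrow> {\<xi> j -` A \<inter> space M | A. A \<in> sets borel}
             | Inr j \<Rightarrow> {u j -` A \<inter> space M | A. A \<in> sets borel}"
  have "indep_sets ?F UNIV" using flight by (simp add: flight_variables_def)
  then show "indep_sets (\<lambda>i. {W i -` A \<inter> space M |A. A \<in> sets borel}) UNIV"
  proof (rule indep_sets_mono_sets)
    fix i :: "nat + nat"
    have 1: "(\<lambda>x::real. (x, 0::R3)) -` A \<in> sets borel" if "A \<in> sets borel" for A
    proof -
      have "(\<lambda>x::real. (x, 0::R3)) \<in> borel_measurable borel" by (simp add: borel_prod[symmetric])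
      from measurable_sets[OF this that] show ?thesis by simp
    qed
    have 2: "(\<lambda>x::R3. (0::real, x)) -` A \<in> sets borel" if "A \<in> sets borel" for A
    proof -
      have "(\<lambda>x::R3. (0::real, x)) \<in> borel_measurable borel" by (simp add: borel_prod[symmetric])
      from measurable_sets[OF this that] show ?thesis by simp
    qed
    show "{W i -` A \<inter> space M |A. A \<in> sets borel} \<subseteq> ?F i"
    proof (cases i)
      case (Inl j)
      have "W i -` A = \<xi> j -` ((\<lambda>x. (x, 0)) -` A)" for A by (auto simp: W_def Inl)
      then show ?thesis using 1 by (auto simp: Inl)
    next
      case (Inr j)
      have "W i -` A = u j -` ((\<lambda>x. (0, x)) -` A)" for A by (auto simp: W_def Inr)
      then show ?thesis using 2 by (auto simp: Inr)
    qed
  qed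
qed simp

text \<open>By independence the joint law of \<open>W i\<close> and the other variables is a
  product, so Tonelli allows integrating over variable i first with all others frozen.\<close>

lemma resample_W:
  assumes [measurable]: "G \<in> borel_measurable (PiM UNIV (\<lambda>_. borel))"
  shows "(\<integral>\<^sup>+\<omega>. G (\<lambda>k. W k \<omega>) \<partial>M) =
    (\<integral>\<^sup>+\<omega>. (\<integral>\<^sup>+y. G ((\<lambda>k. W k \<omega>)(i := y)) \<partial>distr M borel (W i)) \<partial>M)"
proof -
  let ?B = "UNIV - {i}"
  let ?N = "PiM ?B (\<lambda>_. borel) :: (nat + nat \<Rightarrow> real \<times> R3) measure"
  let ?L = "PiM {i} (\<lambda>_. borel) :: (nat + nat \<Rightarrow> real \<times> R3) measure"
  define X where "X \<omega> = restrict (\<lambda>k. W k \<omega>) {i}" for \<omega>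
  define Y where "Y \<omega> = restrict (\<lambda>k. W k \<omega>) ?B" for \<omega>
  have X [measurable]: "X \<in> measurable M ?L"
    unfolding X_def[abs_def] by (intro measurable_restrict) simp
  have Y [measurable]: "Y \<in> measurable M ?N"
    unfolding Y_def[abs_def] by (intro measurable_restrict) simp
  define H where "H = (\<lambda>(x :: nat + nat \<Rightarrow> real \<times> R3, r). G (\<lambda>k. if k = i then x i else r k))"
  have "(\<lambda>(x, r). (\<lambda>k. if k = i then x i else r k)) \<in> measurable (?L \<Otimes>\<^sub>M ?N) (PiM UNIV (\<lambda>_. borel))"
  proof (rule measurable_PiM_single')
    fix k
    show "(\<lambda>x. (case x of (x, r) \<Rightarrow> \<lambda>k. if k = i then x i else r k) k) \<in> borel_measurable (?L \<Otimes>\<^sub>M ?N)"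
      by (cases "k = i") (auto simp: case_prod_beta
          intro!: measurable_compose[OF measurable_snd measurable_component_singleton]
            measurable_compose[OF measurable_fst measurable_component_singleton])
  qed auto
  from measurable_compose[OF this assms]
  have H [measurable]: "H \<in> borel_measurable (?L \<Otimes>\<^sub>M ?N)"
    by (simp add: H_def case_prod_beta)
  have "indep_var ?L X ?N Y"
    unfolding X_def[abs_def] Y_def[abs_def] by (rule indep_var_restrict[OF indep_W]) auto
  then have D: "distr M (?L \<Otimes>\<^sub>M ?N) (\<lambda>\<omega>. (X \<omega>, Y \<omega>)) = distr M ?L X \<Otimes>\<^sub>M distr M ?N Y"
    by (auto simp: indep_var_distribution_eq)
  interpret X: prob_space "distr M ?L X" by (rule prob_space_distr) simp
  interpret Y: prob_space "distr M ?N Y" by (rule prob_space_distr) simp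
  interpret pair_sigma_finite "distr M ?L X" "distr M ?N Y" ..
  \<comment> \<open>Coordinate i is read from one sample point and the rest from another; \<omega>'
    plays the role of an independent copy.\<close>
  have GH: "G ((\<lambda>k. W k \<omega>)(i := W i \<omega>')) = H (X \<omega>', Y \<omega>)" for \<omega> \<omega>'
    unfolding H_def by (auto simp: X_def Y_def intro!: arg_cong[of _ _ G])
  have G [measurable]: "(\<lambda>y. G ((\<lambda>k. W k \<omega>)(i := y))) \<in> borel_measurable borel" for \<omega>
    by (rule measurable_compose[OF _ assms], rule measurable_PiM_single') (auto simp: fun_upd_def)
  have "(\<integral>\<^sup>+\<omega>. G (\<lambda>k. W k \<omega>) \<partial>M) = (\<integral>\<^sup>+\<omega>. H (X \<omega>, Y \<omega>) \<partial>M)"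
    unfolding GH[symmetric] by (simp add: fun_upd_idem)
  also have "\<dots> = (\<integral>\<^sup>+p. H p \<partial>distr M (?L \<Otimes>\<^sub>M ?N) (\<lambda>\<omega>. (X \<omega>, Y \<omega>)))"
    by (subst nn_integral_distr) auto
  also have "\<dots> = (\<integral>\<^sup>+r. \<integral>\<^sup>+x. H (x, r) \<partial>distr M ?L X \<partial>distr M ?N Y)"
    unfolding D by (subst nn_integral_snd[symmetric]) auto
  also have "\<dots> = (\<integral>\<^sup>+\<omega>. \<integral>\<^sup>+x. H (x, Y \<omega>) \<partial>distr M ?L X \<partial>M)"
    by (subst nn_integral_distr) auto
  also have "\<dots> = (\<integral>\<^sup>+\<omega>. \<integral>\<^sup>+\<omega>'. H (X \<omega>', Y \<omega>) \<partial>M \<partial>M)"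
    by (intro nn_integral_cong, subst nn_integral_distr) auto
  also have "\<dots> = (\<integral>\<^sup>+\<omega>. (\<integral>\<^sup>+y. G ((\<lambda>k. W k \<omega>)(i := y)) \<partial>distr M borel (W i)) \<partial>M)"
    unfolding GH[symmetric] by (intro nn_integral_cong, subst nn_integral_distr) auto
  finally show ?thesis .
qed

definition sample :: "'a \<Rightarrow> (nat \<Rightarrow> real) \<times> (nat \<Rightarrow> R3)" where
  "sample \<omega> = (\<lambda>j. \<xi> j \<omega>, \<lambda>j. u j \<omega>)"

lemma measurable_sample [measurable]: "sample \<in> measurable M path_space"
  unfolding sample_def[abs_def] by (intro measurable_Pair measurable_PiM_single') auto

text \<open>Undoes the embedding: applied to \<open>\<lambda>k. W k \<omega>\<close> it returns
  \<open>sample \<omega>\<close>.\<close>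

lemma measurable_decode:
  "(\<lambda>z. (\<lambda>j. fst (z (Inl j)), \<lambda>j. snd (z (Inr j)))) \<in>
     measurable (PiM UNIV (\<lambda>_. borel :: (real \<times> R3) measure)) path_space"
  by (intro measurable_Pair measurable_PiM_single')
     (auto intro!: measurable_compose[OF measurable_component_singleton] simp: borel_prod[symmetric])

lemma resample_\<xi>:
  assumes F [measurable]: "F \<in> borel_measurable path_space"
  shows "(\<integral>\<^sup>+\<omega>. F (sample \<omega>) \<partial>M) =
    (\<integral>\<^sup>+\<omega>. (\<integral>\<^sup>+x. F ((fst (sample \<omega>))(i := x), snd (sample \<omega>)) \<partial>exp_law) \<partial>M)"
proof -
  let ?d = "\<lambda>z :: nat + nat \<Rightarrow> real \<times> R3. (\<lambda>j. fst (z (Inl j)), \<lambda>j. snd (z (Inr j)))"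
  have slice: "(\<lambda>x. F ((fst (sample \<omega>))(i := x), snd (sample \<omega>))) \<in> borel_measurable borel" for \<omega>
    by (rule measurable_compose[OF _ F]) (intro measurable_Pair measurable_PiM_single', auto)
  have "(\<integral>\<^sup>+\<omega>. F (sample \<omega>) \<partial>M) = (\<integral>\<^sup>+\<omega>. F (?d (\<lambda>k. W k \<omega>)) \<partial>M)"
    by (simp add: W_def sample_def)
  also have "\<dots> = (\<integral>\<^sup>+\<omega>. (\<integral>\<^sup>+y. F (?d ((\<lambda>k. W k \<omega>)(Inl i := y))) \<partial>distr M borel (W (Inl i))) \<partial>M)"
    by (rule resample_W) (rule measurable_compose[OF measurable_decode F])
  also have "\<dots> = (\<integral>\<^sup>+\<omega>. (\<integral>\<^sup>+y. F ((fst (sample \<omega>))(i := fst y), snd (sample \<omega>)) \<partial>distr M borel (W (Inl i))) \<partial>M)"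
    by (intro nn_integral_cong arg_cong[of _ _ F]) (auto simp: sample_def W_def fun_eq_iff)
  also have "\<dots> = (\<integral>\<^sup>+\<omega>. (\<integral>\<^sup>+\<omega>'. F ((fst (sample \<omega>))(i := \<xi> i \<omega>'), snd (sample \<omega>)) \<partial>M) \<partial>M)"
    by (intro nn_integral_cong, subst nn_integral_distr)
       (auto simp: W_def intro!: measurable_compose[OF borel_measurable_fst slice])
  also have "\<dots> = (\<integral>\<^sup>+\<omega>. (\<integral>\<^sup>+x. F ((fst (sample \<omega>))(i := x), snd (sample \<omega>)) \<partial>distr M lborel (\<xi> i)) \<partial>M)"
    by (intro nn_integral_cong, subst nn_integral_distr) (auto intro: slice)
  finally show ?thesis unfolding distr_\<xi> .
qed

lemma resample_u:
  assumes F [measurable]: "F \<in> borel_measurable path_space"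
  shows "(\<integral>\<^sup>+\<omega>. F (sample \<omega>) \<partial>M) =
    (\<integral>\<^sup>+\<omega>. (\<integral>\<^sup>+x. F (fst (sample \<omega>), (snd (sample \<omega>))(i := x)) \<partial>uniform_sphere) \<partial>M)"
proof -
  let ?d = "\<lambda>z :: nat + nat \<Rightarrow> real \<times> R3. (\<lambda>j. fst (z (Inl j)), \<lambda>j. snd (z (Inr j)))"
  have slice: "(\<lambda>x. F (fst (sample \<omega>), (snd (sample \<omega>))(i := x))) \<in> borel_measurable borel" for \<omega>
    by (rule measurable_compose[OF _ F]) (intro measurable_Pair measurable_PiM_single', auto)
  have "(\<integral>\<^sup>+\<omega>. F (sample \<omega>) \<partial>M) = (\<integral>\<^sup>+\<omega>. F (?d (\<lambda>k. W k \<omega>)) \<partial>M)"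
    by (simp add: W_def sample_def)
  also have "\<dots> = (\<integral>\<^sup>+\<omega>. (\<integral>\<^sup>+y. F (?d ((\<lambda>k. W k \<omega>)(Inr i := y))) \<partial>distr M borel (W (Inr i))) \<partial>M)"
    by (rule resample_W) (rule measurable_compose[OF measurable_decode F])
  also have "\<dots> = (\<integral>\<^sup>+\<omega>. (\<integral>\<^sup>+y. F (fst (sample \<omega>), (snd (sample \<omega>))(i := snd y)) \<partial>distr M borel (W (Inr i))) \<partial>M)"
    by (intro nn_integral_cong arg_cong[of _ _ F]) (auto simp: sample_def W_def fun_eq_iff)
  also have "\<dots> = (\<integral>\<^sup>+\<omega>. (\<integral>\<^sup>+\<omega>'. F (fst (sample \<omega>), (snd (sample \<omega>))(i := u i \<omega>')) \<partial>M) \<partial>M)"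
    by (intro nn_integral_cong, subst nn_integral_distr)
       (auto simp: W_def intro!: measurable_compose[OF borel_measurable_snd slice])
  also have "\<dots> = (\<integral>\<^sup>+\<omega>. (\<integral>\<^sup>+x. F (fst (sample \<omega>), (snd (sample \<omega>))(i := x)) \<partial>distr M borel (u i)) \<partial>M)"
    by (intro nn_integral_cong, subst nn_integral_distr) (auto intro: slice)
  finally show ?thesis unfolding distr_u .
qed

lemma AE_norm_u: "AE \<omega> in M. \<forall>j. norm (u j \<omega>) = 1"
proof -
  have "AE \<omega> in M. norm (u j \<omega>) = 1" for j
    using AE_uniform_sphere_norm unfolding distr_u[of j, symmetric] by (subst (asm) AE_distr_iff) auto
  then show ?thesis by (simp add: AE_all_countable)
qed

lemma AE_\<xi>_pos: "AE \<omega> in M. \<forall>j. \<xi> j \<omega> > 0"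
proof -
  have "AE \<omega> in M. \<xi> j \<omega> > 0" for j
  proof -
    have "AE x in exp_law. x > 0"
      using AE_lborel_singleton[of "0::real"]
      by (subst AE_density) (auto simp: exponential_density_def elim!: eventually_mono split: if_splits)
    then show ?thesis unfolding distr_\<xi>[of j, symmetric] by (subst (asm) AE_distr_iff) auto
  qed
  then show ?thesis by (simp add: AE_all_countable)
qed

end

subsection \<open>Close encounters\<close>

definition displacement :: "nat set \<Rightarrow> (nat \<Rightarrow> real) \<times> (nat \<Rightarrow> R3) \<Rightarrow> R3" where
  "displacement J = (\<lambda>(\<xi>, u). \<Sum>i\<in>J. \<xi> i *\<^sub>R u i)"

lemma measurable_fst_path [measurable]:
  "(\<lambda>p. fst p i) \<in> borel_measurable path_space"
  by (rule measurable_compose[OF measurable_fst measurable_component_singleton]) simp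

lemma measurable_snd_path [measurable]:
  "(\<lambda>p. snd p i) \<in> borel_measurable path_space"
  by (rule measurable_compose[OF measurable_snd measurable_component_singleton]) simp

lemma measurable_displacement [measurable]: "displacement J \<in> borel_measurable path_space"
  unfolding displacement_def case_prod_beta' by measurable

lemma measurable_cross3 [measurable]:
  assumes [measurable]: "f \<in> borel_measurable N" "g \<in> borel_measurable N"
  shows "(\<lambda>x. cross3 (f x) (g x)) \<in> borel_measurable N"
proof -
  have "(\<lambda>(x, y). cross3 x y) \<in> borel_measurable (borel \<Otimes>\<^sub>M borel)"
    unfolding borel_prod
    by (rule borel_measurable_continuous_onI)
       (simp add: case_prod_beta' continuous_on_cross continuous_on_fst continuous_on_snd continuous_on_id)
  then have "(\<lambda>p. cross3 (fst p) (snd p)) \<in> borel_measurable (borel \<Otimes>\<^sub>M borel)"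
    by (simp add: case_prod_beta')
  from measurable_compose[OF _ this, of "\<lambda>x. (f x, g x)" N] show ?thesis by simp
qed

lemma measurable_transverse [measurable]:
  assumes [measurable]: "f \<in> borel_measurable N" "g \<in> borel_measurable N"
  shows "(\<lambda>x. transverse (f x) (g x)) \<in> borel_measurable N"
  unfolding transverse_def by measurable

lemma displacement_update_time:
  assumes "finite J" "i \<in> J"
  shows "displacement J (a(i := x), b) = x *\<^sub>R b i + displacement (J - {i}) (a, b)"
proof -
  have "(\<Sum>k\<in>J - {i}. (a(i := x)) k *\<^sub>R b k) = (\<Sum>k\<in>J - {i}. a k *\<^sub>R b k)"
    by (rule sum.cong) auto
  then show ?thesis using assms by (simp add: displacement_def sum.remove[of J i])
qed

lemma displacement_update_time':
  assumes "finite J" "i \<in> J"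
  shows "displacement J (a(i := x), b) = displacement J (a, b) + (x - a i) *\<^sub>R b i"
  using displacement_update_time[OF assms, of a x b] displacement_update_time[OF assms, of a "a i" b]
  by (simp add: algebra_simps)

lemma transverse_inner_self:
  assumes "norm e = 1" shows "x \<bullet> transverse e x = (norm (transverse e x))\<^sup>2"
proof -
  have e: "e \<bullet> e = 1" using assms by (simp add: dot_square_norm)
  show ?thesis
    unfolding transverse_def power2_norm_eq_inner inner_diff_left inner_diff_right
      inner_scaleR_left inner_scaleR_right e inner_commute[of x e] by simp
qed

lemma transverse_orthogonal: "norm e = 1 \<Longrightarrow> e \<bullet> transverse e x = 0"
  by (simp add: transverse_def inner_diff inner_commute dot_square_norm)

text \<open>Identifies the coefficient of \<open>\<xi> i\<close> in the constraint defining
  \<open>strip\<close>; in the degenerate case both sides vanish.\<close>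

lemma inner_sgn_transverse:
  assumes "norm e = 1" shows "x \<bullet> sgn (transverse e x) = norm (transverse e x)"
  using transverse_inner_self[OF assms, of x]
  by (cases "transverse e x = 0") (simp_all add: sgn_div_norm power2_eq_square)

text \<open>Both squares equal \<open>x \<bullet> x - (e \<bullet> x)\<^sup>2\<close>. Hence the
  slab normal degenerates exactly where \<open>inv_norm (transverse e x)\<close> is
  infinite.\<close>

lemma norm_transverse_cross:
  assumes "norm e = 1" shows "norm (transverse e x) = norm (cross3 e x)"
proof -
  have e: "e \<bullet> e = 1" using assms by (simp add: dot_square_norm)
  have "(norm (transverse e x))\<^sup>2 = x \<bullet> x - (e \<bullet> x)\<^sup>2"
    unfolding transverse_def power2_norm_eq_inner inner_diff_left inner_diff_right
      inner_scaleR_left inner_scaleR_right e inner_commute[of x e]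
    by (simp add: power2_eq_square)
  also have "\<dots> = (norm (cross3 e x))\<^sup>2"
    using norm_cross[of e x] assms by (simp add: power2_norm_eq_inner)
  finally show ?thesis by simp
qed

text \<open>Projecting along a direction orthogonal to \<open>u j\<close> removes the free parameter
  s. The bound \<open>norm n \<le> 1\<close> admits normals of the form
  \<open>sgn 0\<close>.\<close>

lemma near_imp_projection:
  assumes "near \<rho> \<xi> u J j" "u j \<bullet> n = 0" "norm n \<le> 1"
  shows "\<bar>displacement J (\<xi>, u) \<bullet> n\<bar> \<le> \<rho>"
proof -
  obtain s where s: "norm (displacement J (\<xi>, u) + s *\<^sub>R u j) \<le> \<rho>"
    using assms(1) by (auto simp: near_def displacement_def)
  have "\<bar>displacement J (\<xi>, u) \<bullet> n\<bar> = \<bar>(displacement J (\<xi>, u) + s *\<^sub>R u j) \<bullet> n\<bar>"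
    using assms(2) by (simp add: inner_add_left)
  also have "\<dots> \<le> norm (displacement J (\<xi>, u) + s *\<^sub>R u j) * norm n" by (rule Cauchy_Schwarz_ineq2)
  also have "\<dots> \<le> \<rho> * 1" using s assms(3) by (intro mult_mono) (auto intro: order_trans[OF norm_ge_zero])
  finally show ?thesis by simp
qed

lemma inner_sgn_eq_0: "x \<bullet> y = 0 \<Longrightarrow> x \<bullet> sgn y = 0" for x y :: R3
  by (simp add: sgn_div_norm)

text \<open>
  Both constraints are consequences of \<^const>\<open>near\<close>. The first depends on \<open>\<xi>\<^sub>i\<close>; the second
  does not, its normal being orthogonal to \<open>u\<^sub>i\<close> as well as to \<open>u\<^sub>j\<close>, so that both can be integrated.
\<close>

definition strip :: "real \<Rightarrow> nat set \<Rightarrow> nat \<Rightarrow> nat \<Rightarrow> ((nat \<Rightarrow> real) \<times> (nat \<Rightarrow> R3)) set" where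
  "strip \<rho> J j i = {p. \<bar>displacement J p \<bullet> sgn (transverse (snd p j) (snd p i))\<bar> \<le> \<rho>}"

definition slab :: "real \<Rightarrow> nat set \<Rightarrow> nat \<Rightarrow> nat \<Rightarrow> ((nat \<Rightarrow> real) \<times> (nat \<Rightarrow> R3)) set" where
  "slab \<rho> J j i = {p. \<bar>displacement J p \<bullet> sgn (cross3 (snd p j) (snd p i))\<bar> \<le> \<rho>}"

lemma space_path [simp]: "space path_space = UNIV"
  by (simp add: space_pair_measure space_PiM)

lemma sets_strip [measurable]: "strip \<rho> J j i \<in> sets path_space"
proof -
  have "{p\<in>space path_space. \<bar>displacement J p \<bullet> sgn (transverse (snd p j) (snd p i))\<bar> \<le> \<rho>} \<in> sets path_space"
    by measurable
  then show ?thesis by (simp add: strip_def)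
qed

lemma sets_slab [measurable]: "slab \<rho> J j i \<in> sets path_space"
proof -
  have "{p\<in>space path_space. \<bar>displacement J p \<bullet> sgn (cross3 (snd p j) (snd p i))\<bar> \<le> \<rho>} \<in> sets path_space"
    by measurable
  then show ?thesis by (simp add: slab_def)
qed

lemma near_subset_strip:
  assumes "near \<rho> \<xi> u J j" "norm (u j) = 1" shows "(\<xi>, u) \<in> strip \<rho> J j i"
  unfolding strip_def mem_Collect_eq using assms
  by (intro near_imp_projection[OF assms(1)]) (simp_all add: inner_sgn_eq_0 transverse_orthogonal norm_sgn)

lemma near_subset_slab:
  assumes "near \<rho> \<xi> u J j" shows "(\<xi>, u) \<in> slab \<rho> J j i"
  unfolding slab_def mem_Collect_eq
  by (intro near_imp_projection[OF assms(1)]) (simp_all add: inner_sgn_eq_0 dot_cross_self norm_sgn)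

lemma strip_resample:
  assumes "finite J" "i \<in> J" "\<rho> > 0" "norm (b j) = 1"
  shows "(\<integral>\<^sup>+x. indicator (strip \<rho> J j i) (a(i := x), b) \<partial>exp_law)
     \<le> ennreal (2 * \<rho>) * inv_norm (transverse (b j) (b i))"
proof -
  let ?n = "sgn (transverse (b j) (b i))"
  have "(\<integral>\<^sup>+x. indicator (strip \<rho> J j i) (a(i := x), b) \<partial>exp_law)
     = (\<integral>\<^sup>+x. indicator {x. \<bar>x * norm (transverse (b j) (b i)) + displacement (J - {i}) (a, b) \<bullet> ?n\<bar> \<le> \<rho>} x \<partial>exp_law)"
    by (simp add: strip_def indicator_def displacement_update_time[OF assms(1,2)] inner_add_left
        inner_sgn_transverse[OF assms(4)])
  also have "\<dots> \<le> ennreal (2 * \<rho>) * inverse (ennreal \<bar>norm (transverse (b j) (b i))\<bar>)"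
    by (rule exp_law_interval[OF assms(3)])
  finally show ?thesis by (simp add: inv_norm_def)
qed

lemma slab_resample:
  assumes "finite J" "k \<in> J" "\<rho> > 0"
  shows "(\<integral>\<^sup>+x. indicator (slab \<rho> J j i) (a(k := x), b) \<partial>exp_law)
     \<le> ennreal (2 * \<rho>) * inverse (ennreal \<bar>b k \<bullet> sgn (cross3 (b j) (b i))\<bar>)"
proof -
  let ?n = "sgn (cross3 (b j) (b i))"
  have "(\<integral>\<^sup>+x. indicator (slab \<rho> J j i) (a(k := x), b) \<partial>exp_law)
     = (\<integral>\<^sup>+x. indicator {x. \<bar>x * (b k \<bullet> ?n) + displacement (J - {k}) (a, b) \<bullet> ?n\<bar> \<le> \<rho>} x \<partial>exp_law)"
    by (simp add: slab_def indicator_def displacement_update_time[OF assms(1,2)] inner_add_left)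
  also have "\<dots> \<le> ennreal (2 * \<rho>) * inverse (ennreal \<bar>b k \<bullet> ?n\<bar>)"
    by (rule exp_law_interval[OF assms(3)])
  finally show ?thesis .
qed

lemma slab_update_time:
  assumes "finite J" "i \<in> J"
  shows "(a(i := x), b) \<in> slab \<rho> J j i \<longleftrightarrow> (a, b) \<in> slab \<rho> J j i"
proof -
  have "b i \<bullet> sgn (cross3 (b j) (b i)) = 0" by (simp add: sgn_div_norm dot_cross_self)
  then show ?thesis
    by (simp add: slab_def displacement_update_time'[OF assms] inner_add_left)
qed

section \<open>One linear constraint: a bound of order \<rho>\<close>

context flight
begin

text \<open>The inner integral has to be bounded only for unit directions, as the others form a null
  set.\<close>

lemma resample_\<xi>_le:
  assumes F: "F \<in> borel_measurable path_space"
    and le: "\<And>a b. (\<And>j. norm (b j) = 1) \<Longrightarrow> (\<integral>\<^sup>+x. F (a(i := x), b) \<partial>exp_law) \<le> G (a, b)"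
  shows "(\<integral>\<^sup>+\<omega>. F (sample \<omega>) \<partial>M) \<le> (\<integral>\<^sup>+\<omega>. G (sample \<omega>) \<partial>M)"
  unfolding resample_\<xi>[OF F, of i]
proof (rule nn_integral_mono_AE, rule AE_mp[OF AE_norm_u], rule AE_I2, rule impI)
  fix \<omega> assume "\<forall>j. norm (u j \<omega>) = 1"
  then show "(\<integral>\<^sup>+x. F ((fst (sample \<omega>))(i := x), snd (sample \<omega>)) \<partial>exp_law) \<le> G (sample \<omega>)"
    unfolding sample_def fst_conv snd_conv by (intro le) blast
qed

lemma resample_u_le:
  assumes F: "F \<in> borel_measurable path_space"
    and le: "\<And>a b. (\<And>j. norm (b j) = 1) \<Longrightarrow> (\<integral>\<^sup>+x. F (a, b(i := x)) \<partial>uniform_sphere) \<le> G (a, b)"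
  shows "(\<integral>\<^sup>+\<omega>. F (sample \<omega>) \<partial>M) \<le> (\<integral>\<^sup>+\<omega>. G (sample \<omega>) \<partial>M)"
  unfolding resample_u[OF F, of i]
proof (rule nn_integral_mono_AE, rule AE_mp[OF AE_norm_u], rule AE_I2, rule impI)
  fix \<omega> assume "\<forall>j. norm (u j \<omega>) = 1"
  then show "(\<integral>\<^sup>+x. F (fst (sample \<omega>), (snd (sample \<omega>))(i := x)) \<partial>uniform_sphere) \<le> G (sample \<omega>)"
    unfolding sample_def fst_conv snd_conv by (intro le) blast
qed

lemma inv_norm_sample_le:
  assumes C: "\<And>e. norm e = 1 \<Longrightarrow> (\<integral>\<^sup>+x. inv_norm (transverse e x) \<partial>uniform_sphere) \<le> ennreal C"
    and ij: "i \<noteq> j"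
  shows "(\<integral>\<^sup>+\<omega>. inv_norm (transverse (snd (sample \<omega>) j) (snd (sample \<omega>) i)) \<partial>M) \<le> ennreal C"
proof -
  have "(\<integral>\<^sup>+\<omega>. inv_norm (transverse (snd (sample \<omega>) j) (snd (sample \<omega>) i)) \<partial>M)
     \<le> (\<integral>\<^sup>+\<omega>. (\<lambda>_. ennreal C) (sample \<omega>) \<partial>M)"
    by (rule resample_u_le[where i=i and F="\<lambda>p. inv_norm (transverse (snd p j) (snd p i))"])
       (use C ij in auto)
  then show ?thesis by (simp add: emeasure_space_1)
qed

text \<open>Integrating over \<open>\<xi> i\<close> gives 2 \<rho> over the length of the orthogonal
  part of \<open>u i\<close>; integrating that over \<open>u i\<close>, with \<open>u j\<close>
  frozen, gives at most C.\<close>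

lemma strip_prob:
  assumes C: "\<And>e. norm e = 1 \<Longrightarrow> (\<integral>\<^sup>+x. inv_norm (transverse e x) \<partial>uniform_sphere) \<le> ennreal C"
    and J: "finite J" "i \<in> J" "i \<noteq> j" and \<rho>: "\<rho> > 0"
  shows "(\<integral>\<^sup>+\<omega>. indicator (strip \<rho> J j i) (sample \<omega>) \<partial>M) \<le> ennreal (2 * \<rho>) * ennreal C"
proof -
  have "(\<integral>\<^sup>+\<omega>. indicator (strip \<rho> J j i) (sample \<omega>) \<partial>M)
      \<le> (\<integral>\<^sup>+\<omega>. ennreal (2 * \<rho>) * inv_norm (transverse (snd (sample \<omega>) j) (snd (sample \<omega>) i)) \<partial>M)"
    by (rule resample_\<xi>_le[where i=i and F="indicator (strip \<rho> J j i)"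
          and G="\<lambda>p. ennreal (2 * \<rho>) * inv_norm (transverse (snd p j) (snd p i))"])
       (use strip_resample[OF J(1,2) \<rho>] in auto)
  also have "\<dots> = ennreal (2 * \<rho>) * (\<integral>\<^sup>+\<omega>. inv_norm (transverse (snd (sample \<omega>) j) (snd (sample \<omega>) i)) \<partial>M)"
    by (rule nn_integral_cmult) measurable
  also have "\<dots> \<le> ennreal (2 * \<rho>) * ennreal C"
    by (intro mult_left_mono inv_norm_sample_le[OF C J(3)]) auto
  finally show ?thesis .
qed

end

text \<open>
  In the degenerate case \<open>u\<^sub>j \<times> u\<^sub>i = 0\<close> the factor \<^const>\<open>inv_norm\<close> is infinite on both sides.
\<close>

lemma inv_norm_times_inv_sqrt:
  assumes C: "C > 0" "\<And>e. norm e = 1 \<Longrightarrow> (\<integral>\<^sup>+x. inv_sqrt (x \<bullet> e) \<partial>uniform_sphere) \<le> ennreal C"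
    and e: "norm e = 1"
  shows "inv_norm (transverse e y) * (\<integral>\<^sup>+x. inv_sqrt (x \<bullet> sgn (cross3 e y)) \<partial>uniform_sphere)
     \<le> inv_norm (transverse e y) * ennreal C"
proof (cases "cross3 e y = 0")
  case True
  then have "inv_norm (transverse e y) = \<infinity>"
    using norm_transverse_cross[OF e, of y] by (simp add: inv_norm_def)
  then show ?thesis using C(1) by (simp add: ennreal_top_mult)
next
  case False
  then show ?thesis by (intro mult_left_mono C(2)) (simp_all add: norm_sgn)
qed

lemma inverse_eq_inv_sqrt: "inverse (ennreal \<bar>x\<bar>) = inv_sqrt x * inv_sqrt x"
proof -
  have "ennreal \<bar>x\<bar> = ennreal (sqrt \<bar>x\<bar>) * ennreal (sqrt \<bar>x\<bar>)"
    by (simp add: ennreal_mult'[symmetric])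
  then show ?thesis unfolding inv_sqrt_def by (simp only: ennreal_inverse_mult ennreal_less_top)
qed

lemma inverse_le_inv_sqrt:
  assumes "\<bar>y\<bar> \<le> \<bar>x\<bar>" shows "inverse (ennreal \<bar>x\<bar>) \<le> inv_sqrt x * inv_sqrt y"
  unfolding inverse_eq_inv_sqrt by (intro mult_left_mono inv_sqrt_antimono assms) simp

section \<open>Two linear constraints: a bound of order \<rho> squared\<close>

context flight
begin

text \<open>For unit directions, the reciprocal of the sine of the angle between \<open>u j\<close>
  and \<open>u i\<close>.\<close>

definition spread :: "nat \<Rightarrow> nat \<Rightarrow> (nat \<Rightarrow> real) \<times> (nat \<Rightarrow> R3) \<Rightarrow> ennreal" where
  "spread j i p = inv_norm (transverse (snd p j) (snd p i))"

definition tilt :: "nat \<Rightarrow> nat \<Rightarrow> nat \<Rightarrow> (nat \<Rightarrow> real) \<times> (nat \<Rightarrow> R3) \<Rightarrow> real" where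
  "tilt j i k p = snd p k \<bullet> sgn (cross3 (snd p j) (snd p i))"

lemma measurable_spread [measurable]: "spread j i \<in> borel_measurable path_space"
  unfolding spread_def by measurable

lemma measurable_tilt [measurable]: "tilt j i k \<in> borel_measurable path_space"
  unfolding tilt_def by measurable

text \<open>
  \<open>Q\<close> selects the directions for which step \<open>k\<close> has the larger component along the normal. There
  \<open>1/\<bar>x\<^sub>k\<bar>\<close>, not integrable by itself, is dominated by \<open>\<bar>x\<^sub>k x\<^sub>l\<bar>\<close> to the power \<open>-1/2\<close>, which is.
\<close>

lemma slab_prob_time:
  assumes J: "finite J" "k \<in> J" and \<rho>: "\<rho> > 0"
    and Q [measurable]: "Q \<in> sets path_space" and Qu: "\<And>a a' b. (a, b) \<in> Q \<Longrightarrow> (a', b) \<in> Q"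
    and le: "\<And>p. p \<in> Q \<Longrightarrow> \<bar>tilt j i l p\<bar> \<le> \<bar>tilt j i k p\<bar>"
  shows "(\<integral>\<^sup>+\<omega>. spread j i (sample \<omega>) * indicator (slab \<rho> J j i) (sample \<omega>) * indicator Q (sample \<omega>) \<partial>M)
   \<le> (\<integral>\<^sup>+\<omega>. ennreal (2 * \<rho>) * (spread j i (sample \<omega>) * (inv_sqrt (tilt j i k (sample \<omega>)) * inv_sqrt (tilt j i l (sample \<omega>))))
          * indicator Q (sample \<omega>) \<partial>M)"
proof (rule resample_\<xi>_le[where i=k and F="\<lambda>p. spread j i p * indicator (slab \<rho> J j i) p * indicator Q p"
    and G="\<lambda>p. ennreal (2 * \<rho>) * (spread j i p * (inv_sqrt (tilt j i k p) * inv_sqrt (tilt j i l p))) * indicator Q p"])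
  show "(\<lambda>p. spread j i p * indicator (slab \<rho> J j i) p * indicator Q p) \<in> borel_measurable path_space"
    by measurable
  fix a and b :: "nat \<Rightarrow> R3"
  let ?S = "inv_norm (transverse (b j) (b i))"
  have [measurable]: "(\<lambda>x. indicator (slab \<rho> J j i) (a(k := x), b) :: ennreal) \<in> borel_measurable borel"
    by (rule measurable_compose[OF _ borel_measurable_indicator[OF sets_slab]])
       (intro measurable_Pair measurable_PiM_single', auto)
  \<comment> \<open>Q restricts directions only, so it is unaffected by resampling the time
    k.\<close>
  have Qa: "indicator Q (a(k := x), b) = (indicator Q (a, b) :: ennreal)" for x
    using Qu by (auto simp: indicator_def)
  have "(\<integral>\<^sup>+x. spread j i (a(k := x), b) * indicator (slab \<rho> J j i) (a(k := x), b) * indicator Q (a(k := x), b) \<partial>exp_law)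
     = ?S * (\<integral>\<^sup>+x. indicator (slab \<rho> J j i) (a(k := x), b) \<partial>exp_law) * indicator Q (a, b)"
    unfolding Qa by (simp add: spread_def nn_integral_cmult nn_integral_multc)
  also have "\<dots> \<le> ?S * (ennreal (2 * \<rho>) * inverse (ennreal \<bar>tilt j i k (a, b)\<bar>)) * indicator Q (a, b)"
    using slab_resample[OF J \<rho>, of j i a b] unfolding tilt_def snd_conv
    by (intro mult_right_mono mult_left_mono) auto
  also have "\<dots> \<le> ?S * (ennreal (2 * \<rho>) * (inv_sqrt (tilt j i k (a, b)) * inv_sqrt (tilt j i l (a, b)))) * indicator Q (a, b)"
  proof (cases "(a, b) \<in> Q")
    case True
    show ?thesis by (intro mult_right_mono mult_left_mono inverse_le_inv_sqrt le True) auto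
  qed simp
  finally show "(\<integral>\<^sup>+x. spread j i (a(k := x), b) * indicator (slab \<rho> J j i) (a(k := x), b) * indicator Q (a(k := x), b) \<partial>exp_law)
     \<le> ennreal (2 * \<rho>) * (spread j i (a, b) * (inv_sqrt (tilt j i k (a, b)) * inv_sqrt (tilt j i l (a, b)))) * indicator Q (a, b)"
    by (simp add: spread_def mult_ac)
qed

text \<open>Integrates over \<open>u k\<close> while \<open>spread\<close>, the normal and G stay
  frozen. Carrying the factor \<open>spread\<close> keeps the bound valid when the normal
  vanishes.\<close>

lemma tilt_integral_le:
  assumes C: "C > 0" "\<And>e. norm e = 1 \<Longrightarrow> (\<integral>\<^sup>+x. inv_sqrt (x \<bullet> e) \<partial>uniform_sphere) \<le> ennreal C"
    and ne: "k \<noteq> j" "k \<noteq> i"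
    and G [measurable]: "G \<in> borel_measurable path_space" and Gk: "\<And>a b x. G (a, b(k := x)) = G (a, b)"
  shows "(\<integral>\<^sup>+\<omega>. G (sample \<omega>) * (spread j i (sample \<omega>) * inv_sqrt (tilt j i k (sample \<omega>))) \<partial>M)
     \<le> (\<integral>\<^sup>+\<omega>. G (sample \<omega>) * (spread j i (sample \<omega>) * ennreal C) \<partial>M)"
proof (rule resample_u_le[where i=k and F="\<lambda>p. G p * (spread j i p * inv_sqrt (tilt j i k p))"
      and G="\<lambda>p. G p * (spread j i p * ennreal C)"])
  show "(\<lambda>p. G p * (spread j i p * inv_sqrt (tilt j i k p))) \<in> borel_measurable path_space"
    by measurable
  fix a and b :: "nat \<Rightarrow> R3" assume b: "\<And>j. norm (b j) = 1"
  have "(\<integral>\<^sup>+x. G (a, b(k := x)) * (spread j i (a, b(k := x)) * inv_sqrt (tilt j i k (a, b(k := x)))) \<partial>uniform_sphere)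
     = (\<integral>\<^sup>+x. G (a, b) * (inv_norm (transverse (b j) (b i)) * inv_sqrt (x \<bullet> sgn (cross3 (b j) (b i)))) \<partial>uniform_sphere)"
    using ne by (simp add: Gk spread_def tilt_def)
  also have "\<dots> = G (a, b) * (inv_norm (transverse (b j) (b i)) * (\<integral>\<^sup>+x. inv_sqrt (x \<bullet> sgn (cross3 (b j) (b i))) \<partial>uniform_sphere))"
    by (simp add: nn_integral_cmult)
  also have "\<dots> \<le> G (a, b) * (inv_norm (transverse (b j) (b i)) * ennreal C)"
    by (intro mult_left_mono inv_norm_times_inv_sqrt[OF C b]) auto
  finally show "(\<integral>\<^sup>+x. G (a, b(k := x)) * (spread j i (a, b(k := x)) * inv_sqrt (tilt j i k (a, b(k := x)))) \<partial>uniform_sphere)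
     \<le> G (a, b) * (spread j i (a, b) * ennreal C)" by (simp add: spread_def)
qed

text \<open>The variables are integrated in the order \<open>\<xi> i\<close>, then
  \<open>\<xi> k\<close> or \<open>\<xi> l\<close>, then \<open>u l\<close>, \<open>u k\<close>,
  \<open>u i\<close>. Each of the two times costs a factor 2 \<rho>, each of the three directions a
  factor C.\<close>

lemma slab_prob:
  assumes C: "C > 0" "\<And>e. norm e = 1 \<Longrightarrow> (\<integral>\<^sup>+x. inv_sqrt (x \<bullet> e) \<partial>uniform_sphere) \<le> ennreal C"
      "\<And>e. norm e = 1 \<Longrightarrow> (\<integral>\<^sup>+x. inv_norm (transverse e x) \<partial>uniform_sphere) \<le> ennreal C"
    and J: "finite J" "i \<in> J" "k \<in> J" "l \<in> J" and d: "distinct [i, k, l, j]" and \<rho>: "\<rho> > 0"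
  shows "(\<integral>\<^sup>+\<omega>. indicator (strip \<rho> J j i \<inter> slab \<rho> J j i) (sample \<omega>) \<partial>M) \<le> ennreal ((2 * \<rho>)\<^sup>2 * C ^ 3)"
proof -
  define Q where "Q = {p :: (nat \<Rightarrow> real) \<times> (nat \<Rightarrow> R3). \<bar>tilt j i l p\<bar> \<le> \<bar>tilt j i k p\<bar>}"
  have "{p \<in> space path_space. \<bar>tilt j i l p\<bar> \<le> \<bar>tilt j i k p\<bar>} \<in> sets path_space" by measurable
  then have Q [measurable]: "Q \<in> sets path_space" by (simp add: Q_def)
  then have Q' [measurable]: "- Q \<in> sets path_space"
    using sets.compl_sets[OF Q] by (simp add: Compl_eq_Diff_UNIV)
  let ?\<rho> = "ennreal (2 * \<rho>)"
  let ?S = "\<lambda>\<omega>. spread j i (sample \<omega>)" and ?I = "\<lambda>\<omega>. indicator (slab \<rho> J j i) (sample \<omega>) :: ennreal"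
  let ?t = "\<lambda>k \<omega>. inv_sqrt (tilt j i k (sample \<omega>))"
  have "(\<integral>\<^sup>+\<omega>. indicator (strip \<rho> J j i \<inter> slab \<rho> J j i) (sample \<omega>) \<partial>M)
     \<le> (\<integral>\<^sup>+\<omega>. ?\<rho> * (?S \<omega> * ?I \<omega>) \<partial>M)"
  proof (rule resample_\<xi>_le[where i=i and F="indicator (strip \<rho> J j i \<inter> slab \<rho> J j i)"
        and G="\<lambda>p. ?\<rho> * (spread j i p * indicator (slab \<rho> J j i) p)"])
    fix a and b :: "nat \<Rightarrow> R3" assume b: "\<And>j. norm (b j) = 1"
    have sl: "indicator (slab \<rho> J j i) (a(i := x), b) = (indicator (slab \<rho> J j i) (a, b) :: ennreal)" for x
      using slab_update_time[OF J(1,2), of a x b \<rho> j] by (simp add: indicator_def)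
    have [measurable]: "(\<lambda>x. indicator (strip \<rho> J j i) (a(i := x), b) :: ennreal) \<in> borel_measurable borel"
      by (rule measurable_compose[OF _ borel_measurable_indicator[OF sets_strip]])
         (intro measurable_Pair measurable_PiM_single', auto)
    have "(\<integral>\<^sup>+x. indicator (strip \<rho> J j i \<inter> slab \<rho> J j i) (a(i := x), b) \<partial>exp_law)
       = (\<integral>\<^sup>+x. indicator (strip \<rho> J j i) (a(i := x), b) \<partial>exp_law) * indicator (slab \<rho> J j i) (a, b)"
      by (simp add: indicator_inter_arith sl nn_integral_multc)
    also have "\<dots> \<le> ?\<rho> * inv_norm (transverse (b j) (b i)) * indicator (slab \<rho> J j i) (a, b)"
      by (intro mult_right_mono strip_resample[OF J(1,2) \<rho> b]) auto
    finally show "(\<integral>\<^sup>+x. indicator (strip \<rho> J j i \<inter> slab \<rho> J j i) (a(i := x), b) \<partial>exp_law)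
       \<le> ?\<rho> * (spread j i (a, b) * indicator (slab \<rho> J j i) (a, b))"
      by (simp add: spread_def mult_ac)
  qed measurable
  also have "\<dots> = ?\<rho> * ((\<integral>\<^sup>+\<omega>. ?S \<omega> * ?I \<omega> * indicator Q (sample \<omega>) \<partial>M)
       + (\<integral>\<^sup>+\<omega>. ?S \<omega> * ?I \<omega> * indicator (- Q) (sample \<omega>) \<partial>M))"
    by (subst nn_integral_add[symmetric])
       (auto simp: nn_integral_cmult[symmetric] indicator_def intro!: nn_integral_cong)
  \<comment> \<open>On the complement of Q the steps k and l exchange roles. The resulting bound is
    symmetric in them, so the two pieces recombine into one integral.\<close>
  also have "\<dots> \<le> ?\<rho> * ((\<integral>\<^sup>+\<omega>. ?\<rho> * (?S \<omega> * (?t k \<omega> * ?t l \<omega>)) * indicator Q (sample \<omega>) \<partial>M)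
       + (\<integral>\<^sup>+\<omega>. ?\<rho> * (?S \<omega> * (?t l \<omega> * ?t k \<omega>)) * indicator (- Q) (sample \<omega>) \<partial>M))"
    by (intro mult_left_mono add_mono slab_prob_time J \<rho> Q Q')
       (auto simp: Q_def tilt_def)
  also have "\<dots> = ?\<rho> * (\<integral>\<^sup>+\<omega>. ?\<rho> * ?t k \<omega> * (?S \<omega> * ?t l \<omega>) \<partial>M)"
    by (subst nn_integral_add[symmetric])
       (auto simp: indicator_def mult_ac intro!: arg_cong2[of _ _ _ _ "(*)"] nn_integral_cong)
  also have "\<dots> \<le> ?\<rho> * (\<integral>\<^sup>+\<omega>. ?\<rho> * ?t k \<omega> * (?S \<omega> * ennreal C) \<partial>M)"
    by (intro mult_left_mono tilt_integral_le[where G="\<lambda>p. ?\<rho> * inv_sqrt (tilt j i k p)"] C)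
       (use d in \<open>auto simp: tilt_def\<close>)
  also have "\<dots> = ?\<rho> * (\<integral>\<^sup>+\<omega>. ?\<rho> * ennreal C * (?S \<omega> * ?t k \<omega>) \<partial>M)"
    by (simp add: mult_ac)
  also have "\<dots> \<le> ?\<rho> * (\<integral>\<^sup>+\<omega>. ?\<rho> * ennreal C * (?S \<omega> * ennreal C) \<partial>M)"
    by (intro mult_left_mono tilt_integral_le[where G="\<lambda>p. ?\<rho> * ennreal C"] C) (use d in auto)
  also have "\<dots> = ?\<rho> * (?\<rho> * ennreal C * ennreal C * (\<integral>\<^sup>+\<omega>. ?S \<omega> \<partial>M))"
    by (subst nn_integral_cmult[symmetric]) (auto simp: mult_ac)
  also have "\<dots> \<le> ?\<rho> * (?\<rho> * ennreal C * ennreal C * ennreal C)"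
    unfolding spread_def using d by (intro mult_left_mono inv_norm_sample_le C) auto
  also have "\<dots> = ennreal ((2 * \<rho>)\<^sup>2 * C ^ 3)"
    using \<rho> C(1) by (simp add: ennreal_mult'[symmetric] power2_eq_square power3_eq_cube mult_ac)
  finally show ?thesis .
qed

end

section \<open>Tail of the flight time and the union bound\<close>

context flight
begin

lemma measurable_flight_time [measurable]: "(\<lambda>\<omega>. flight_time (\<lambda>j. \<xi> j \<omega>) K) \<in> borel_measurable M"
  unfolding flight_time_def by measurable

lemma flight_time_laplace:
  "(\<integral>\<^sup>+\<omega>. ennreal (exp (- flight_time (\<lambda>j. \<xi> j \<omega>) K)) \<partial>M) \<le> ennreal ((1/2) ^ K)"
proof (induction K)
  case 0
  show ?case by (simp add: flight_time_def emeasure_space_1)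
next
  case (Suc K)
  have "(\<integral>\<^sup>+\<omega>. ennreal (exp (- flight_time (fst (sample \<omega>)) (Suc K))) \<partial>M)
     \<le> (\<integral>\<^sup>+\<omega>. ennreal (exp (- flight_time (fst (sample \<omega>)) K)) * ennreal (1/2) \<partial>M)"
  proof (rule resample_\<xi>_le[where i="Suc K" and F="\<lambda>p. ennreal (exp (- flight_time (fst p) (Suc K)))"
        and G="\<lambda>p. ennreal (exp (- flight_time (fst p) K)) * ennreal (1/2)"])
    show "(\<lambda>p. ennreal (exp (- flight_time (fst p) (Suc K)))) \<in> borel_measurable path_space"
      unfolding flight_time_def by measurable
    fix a :: "nat \<Rightarrow> real" and b :: "nat \<Rightarrow> R3"
    have "flight_time (a(Suc K := x)) K = flight_time a K" for x
      unfolding flight_time_def by (rule sum.cong) auto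
    then have "flight_time (a(Suc K := x)) (Suc K) = flight_time a K + x" for x
      by (simp add: flight_time_def)
    then have e: "ennreal (exp (- flight_time (a(Suc K := x)) (Suc K)))
        = ennreal (exp (- flight_time a K)) * ennreal (exp (- x))" for x
      by (simp only: ennreal_mult'[symmetric] exp_ge_zero exp_add[symmetric] minus_add_distrib)
    have "(\<integral>\<^sup>+x. ennreal (exp (- flight_time a K)) * ennreal (exp (- x)) \<partial>exp_law)
       = ennreal (exp (- flight_time a K)) * ennreal (1/2)"
      unfolding nn_integral_exp_law_exp[symmetric] by (rule nn_integral_cmult) simp
    then show "(\<integral>\<^sup>+x. ennreal (exp (- flight_time (fst (a(Suc K := x), b)) (Suc K))) \<partial>exp_law)
       \<le> ennreal (exp (- flight_time (fst (a, b)) K)) * ennreal (1/2)"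
      unfolding fst_conv e by (rule eq_refl)
  qed
  also have "\<dots> = (\<integral>\<^sup>+\<omega>. ennreal (exp (- flight_time (fst (sample \<omega>)) K)) \<partial>M) * ennreal (1/2)"
    by (rule nn_integral_multc) (simp add: sample_def)
  also have "\<dots> \<le> ennreal ((1/2) ^ K) * ennreal (1/2)"
    using Suc.IH by (intro mult_right_mono) (auto simp: sample_def)
  also have "\<dots> = ennreal ((1/2) ^ Suc K)"
    unfolding power_Suc2 by (rule ennreal_mult[symmetric]) auto
  finally show ?case by (simp add: sample_def)
qed

text \<open>Exponential Markov inequality: \<open>exp (t - flight_time)\<close> is at least 1 on the
  event.\<close>

lemma flight_time_tail:
  "emeasure M {\<omega> \<in> space M. flight_time (\<lambda>j. \<xi> j \<omega>) K \<le> t} \<le> ennreal (exp t * (1/2) ^ K)"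
proof -
  have "emeasure M {\<omega> \<in> space M. flight_time (\<lambda>j. \<xi> j \<omega>) K \<le> t}
      = (\<integral>\<^sup>+\<omega>. indicator {\<omega> \<in> space M. flight_time (\<lambda>j. \<xi> j \<omega>) K \<le> t} \<omega> \<partial>M)"
    by (rule nn_integral_indicator[symmetric]) measurable
  also have "\<dots> \<le> (\<integral>\<^sup>+\<omega>. ennreal (exp t) * ennreal (exp (- flight_time (\<lambda>j. \<xi> j \<omega>) K)) \<partial>M)"
    by (intro nn_integral_mono)
       (auto simp: indicator_def ennreal_mult'[symmetric] exp_add[symmetric] ennreal_1[symmetric]
          simp del: ennreal_1 intro!: ennreal_leI)
  also have "\<dots> = ennreal (exp t) * (\<integral>\<^sup>+\<omega>. ennreal (exp (- flight_time (\<lambda>j. \<xi> j \<omega>) K)) \<partial>M)"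
    by (rule nn_integral_cmult) measurable
  also have "\<dots> \<le> ennreal (exp t) * ennreal ((1/2) ^ K)"
    by (intro mult_left_mono flight_time_laplace) auto
  finally show ?thesis by (simp add: ennreal_mult')
qed

text \<open>For unit directions this contains the event
  \<open>near \<rho> \<xi> u {k+1..n} j\<close>. The slab is imposed only from three steps on,
  because its estimate uses the distinct steps k + 1, k + 2 and k + 3.\<close>

definition close_set :: "real \<Rightarrow> nat \<Rightarrow> nat \<Rightarrow> nat \<Rightarrow> 'a set" where
  "close_set \<rho> k n j = {\<omega> \<in> space M. sample \<omega> \<in> strip \<rho> {k+1..n} j (k+1) \<and>
      (k + 3 \<le> n \<longrightarrow> sample \<omega> \<in> slab \<rho> {k+1..n} j (k+1))}"

lemma sets_close_set [measurable]: "close_set \<rho> k n j \<in> sets M"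
  unfolding close_set_def by measurable

lemma emeasure_close_set:
  assumes C: "C > 0" "\<And>e. norm e = 1 \<Longrightarrow> (\<integral>\<^sup>+x. inv_sqrt (x \<bullet> e) \<partial>uniform_sphere) \<le> ennreal C"
      "\<And>e. norm e = 1 \<Longrightarrow> (\<integral>\<^sup>+x. inv_norm (transverse e x) \<partial>uniform_sphere) \<le> ennreal C"
    and k: "k < n" "j \<notin> {k+1..n}" and \<rho>: "\<rho> > 0"
  shows "emeasure M (close_set \<rho> k n j) \<le> ennreal (2 * \<rho> * C * of_bool (n \<le> k + 2) + (2 * \<rho>)\<^sup>2 * C ^ 3)"
proof (cases "n \<le> k + 2")
  case True
  have "emeasure M (close_set \<rho> k n j) = (\<integral>\<^sup>+\<omega>. indicator (close_set \<rho> k n j) \<omega> \<partial>M)" by simp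
  also have "\<dots> \<le> (\<integral>\<^sup>+\<omega>. indicator (strip \<rho> {k+1..n} j (k+1)) (sample \<omega>) \<partial>M)"
    by (intro nn_integral_mono indicator_leI) (simp add: close_set_def)
  also have "\<dots> \<le> ennreal (2 * \<rho>) * ennreal C"
    by (rule strip_prob[OF C(3)]) (use k \<rho> in auto)
  also have "\<dots> = ennreal (2 * \<rho> * C)" using \<rho> C(1) by (simp add: ennreal_mult')
  also have "\<dots> \<le> ennreal (2 * \<rho> * C * of_bool (n \<le> k + 2) + (2 * \<rho>)\<^sup>2 * C ^ 3)"
    using True C(1) by (intro ennreal_leI) simp
  finally show ?thesis .
next
  case False
  have "emeasure M (close_set \<rho> k n j) = (\<integral>\<^sup>+\<omega>. indicator (close_set \<rho> k n j) \<omega> \<partial>M)" by simp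
  also have "\<dots> \<le> (\<integral>\<^sup>+\<omega>. indicator (strip \<rho> {k+1..n} j (k+1) \<inter> slab \<rho> {k+1..n} j (k+1)) (sample \<omega>) \<partial>M)"
    using False by (intro nn_integral_mono indicator_leI) (simp add: close_set_def)
  also have "\<dots> \<le> ennreal ((2 * \<rho>)\<^sup>2 * C ^ 3)"
    by (rule slab_prob[OF C, where k="k+2" and l="k+3"]) (use k \<rho> False in auto)
  finally show ?thesis using False by simp
qed

lemma outer_measure_discrepancy_le:
  assumes C: "C > 0" "\<And>e. norm e = 1 \<Longrightarrow> (\<integral>\<^sup>+x. inv_sqrt (x \<bullet> e) \<partial>uniform_sphere) \<le> ennreal C"
      "\<And>e. norm e = 1 \<Longrightarrow> (\<integral>\<^sup>+x. inv_norm (transverse e x) \<partial>uniform_sphere) \<le> ennreal C"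
    and r: "r > 0"
  shows "outer_measure_of M {\<omega> \<in> space M.
           first_discrepancy (lorentz_process r (\<lambda>j. \<xi> j \<omega>) (\<lambda>j. u j \<omega>))
             (flight_process (\<lambda>j. \<xi> j \<omega>) (\<lambda>j. u j \<omega>)) \<le> ereal t}
     \<le> ennreal (exp t * (1/2) ^ K + (24 * C * (r * (K + 1)) + 72 * C ^ 3 * (r * (K + 1))\<^sup>2))"
    (is "outer_measure_of M ?D \<le> _")
proof -
  define I where "I = (SIGMA n:{..K}. {..<n})"
  have "AE \<omega> in M. \<forall>j. \<xi> j \<omega> > 0 \<and> norm (u j \<omega>) = 1"
    using AE_norm_u AE_\<xi>_pos by eventually_elim auto
  then obtain Z where Z: "{\<omega> \<in> space M. \<not> (\<forall>j. \<xi> j \<omega> > 0 \<and> norm (u j \<omega>) = 1)} \<subseteq> Z"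
    "emeasure M Z = 0" "Z \<in> sets M" by (rule AE_E)
  define L where "L = {\<omega> \<in> space M. flight_time (\<lambda>j. \<xi> j \<omega>) K \<le> t}"
  have L [measurable]: "L \<in> sets M" unfolding L_def by measurable
  define E where "E = (\<Union>(n, k)\<in>I. close_set (3 * r) k n k \<union> close_set (3 * r) k n (Suc n))"
  have fin: "finite I" unfolding I_def by auto
  have E [measurable]: "E \<in> sets M" unfolding E_def using fin by (auto intro!: sets.finite_UN)
  \<comment> \<open>Outside the null set Z, without close encounters, the paths agree up to the
    flight time of vertex K. A discrepancy by time t then forces this flight time to be at most
    t.\<close>
  have sub: "?D \<subseteq> Z \<union> L \<union> E"
  proof
    fix \<omega> assume \<omega>: "\<omega> \<in> ?D"
    show "\<omega> \<in> Z \<union> L \<union> E"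
    proof (rule ccontr)
      assume c: "\<omega> \<notin> Z \<union> L \<union> E"
      then have reg: "\<xi> j \<omega> > 0" "norm (u j \<omega>) = 1" for j using Z(1) \<omega> by auto
      interpret flight_path "\<lambda>j. \<xi> j \<omega>" "\<lambda>j. u j \<omega>" by unfold_locales (use reg in auto)
      have "\<not> entangled (3 * r) (\<lambda>j. \<xi> j \<omega>) (\<lambda>j. u j \<omega>) K"
      proof
        assume "entangled (3 * r) (\<lambda>j. \<xi> j \<omega>) (\<lambda>j. u j \<omega>) K"
        then obtain k n j where kn: "k < n" "n \<le> K" "j = k \<or> j = Suc n"
          and nr: "near (3 * r) (\<lambda>j. \<xi> j \<omega>) (\<lambda>j. u j \<omega>) {k+1..n} j"
          by (auto simp: entangled_def)
        have "\<omega> \<in> close_set (3 * r) k n j"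
          using \<omega> near_subset_strip[OF nr] near_subset_slab[OF nr] reg
          unfolding close_set_def sample_def by auto
        moreover have "(n, k) \<in> I" using kn by (auto simp: I_def)
        ultimately have "\<omega> \<in> E" unfolding E_def using kn(3) by auto
        with c show False by simp
      qed
      from first_discrepancy_ge[OF r this] have "ereal (flight_time (\<lambda>j. \<xi> j \<omega>) K) \<le> ereal t"
        by (rule order_trans) (use \<omega> in blast)
      then have "\<omega> \<in> L" using \<omega> by (simp add: L_def)
      with c show False by simp
    qed
  qed
  have "emeasure M E \<le> (\<Sum>(n, k)\<in>I. emeasure M (close_set (3 * r) k n k \<union> close_set (3 * r) k n (Suc n)))"
    unfolding E_def case_prod_beta by (rule emeasure_subadditive_finite) (use fin in auto)
  also have "\<dots> \<le> (\<Sum>(n, k)\<in>I. ennreal (2 * (6 * r * C * of_bool (n \<le> k + 2) + (6 * r)\<^sup>2 * C ^ 3)))"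
  proof (rule sum_mono, clarify)
    fix n k assume "(n, k) \<in> I"
    then have kn: "k < n" by (auto simp: I_def)
    let ?b = "6 * r * C * of_bool (n \<le> k + 2) + (6 * r)\<^sup>2 * C ^ 3"
    have "emeasure M (close_set (3 * r) k n k \<union> close_set (3 * r) k n (Suc n))
       \<le> emeasure M (close_set (3 * r) k n k) + emeasure M (close_set (3 * r) k n (Suc n))"
      by (rule emeasure_subadditive) auto
    also have "\<dots> \<le> ennreal ?b + ennreal ?b"
      using emeasure_close_set[OF C kn, of k "3 * r"] emeasure_close_set[OF C kn, of "Suc n" "3 * r"] r
      by (intro add_mono) simp_all
    also have "\<dots> = ennreal (?b + ?b)"
      using r C(1) by (intro ennreal_plus[symmetric]) auto
    also have "?b + ?b = 2 * ?b" by simp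
    finally show "emeasure M (close_set (3 * r) k n k \<union> close_set (3 * r) k n (Suc n)) \<le> ennreal (2 * ?b)" .
  qed
  also have "\<dots> = ennreal (\<Sum>(n, k)\<in>I. 2 * (6 * r * C * of_bool (n \<le> k + 2) + (6 * r)\<^sup>2 * C ^ 3))"
    unfolding case_prod_beta using r C(1) by (intro sum_ennreal) auto
  also have "(\<Sum>(n, k)\<in>I. 2 * (6 * r * C * of_bool (n \<le> k + 2) + (6 * r)\<^sup>2 * C ^ 3))
     = (\<Sum>n\<le>K. \<Sum>k<n. 2 * (6 * r * C * of_bool (n \<le> k + 2) + (6 * r)\<^sup>2 * C ^ 3))"
    unfolding I_def by (rule sum.Sigma[symmetric]) auto
  also have "\<dots> \<le> (\<Sum>n\<le>K. 24 * r * C + 72 * r\<^sup>2 * C ^ 3 * (K + 1))"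
  proof (rule sum_mono)
    fix n assume n: "n \<in> {..K}"
    \<comment> \<open>For each n at most the two values n - 1 and n - 2 of k contribute to first
      order in r, so this part of the double sum grows only linearly in K.\<close>
    have "(\<Sum>k<n. of_bool (n \<le> k + 2) :: real) = real (card ({..<n} \<inter> {k. n \<le> k + 2}))"
      by (simp add: sum_of_bool_eq)
    also have "card ({..<n} \<inter> {k. n \<le> k + 2}) \<le> card {n - 2..<n}"
      by (rule card_mono) auto
    finally have c: "(\<Sum>k<n. of_bool (n \<le> k + 2) :: real) \<le> 2" by simp
    have "(\<Sum>k<n. 2 * (6 * r * C * of_bool (n \<le> k + 2) + (6 * r)\<^sup>2 * C ^ 3))
       = (\<Sum>k<n. 12 * r * C * of_bool (n \<le> k + 2) + 72 * r\<^sup>2 * C ^ 3)"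
      by (rule sum.cong) (simp_all add: algebra_simps power2_eq_square)
    also have "\<dots> = 12 * r * C * (\<Sum>k<n. of_bool (n \<le> k + 2)) + 72 * r\<^sup>2 * C ^ 3 * n"
      unfolding sum.distrib sum_distrib_left[symmetric] by simp
    also have "\<dots> \<le> 12 * r * C * 2 + 72 * r\<^sup>2 * C ^ 3 * (K + 1)"
      using c r C(1) n by (intro add_mono mult_left_mono) auto
    finally show "(\<Sum>k<n. 2 * (6 * r * C * of_bool (n \<le> k + 2) + (6 * r)\<^sup>2 * C ^ 3))
       \<le> 24 * r * C + 72 * r\<^sup>2 * C ^ 3 * (K + 1)" by simp
  qed
  also have "\<dots> = 24 * C * (r * (K + 1)) + 72 * C ^ 3 * (r * (K + 1))\<^sup>2"
    by (simp add: algebra_simps power2_eq_square)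
  finally have E_le: "emeasure M E \<le> ennreal (24 * C * (r * (K + 1)) + 72 * C ^ 3 * (r * (K + 1))\<^sup>2)"
    by (simp add: ennreal_leI)
  \<comment> \<open>The outer measure is an infimum over measurable supersets, so the discrepancy
    event itself need not be shown measurable.\<close>
  have "outer_measure_of M ?D \<le> emeasure M (Z \<union> L \<union> E)"
    unfolding outer_measure_of_def using sub Z(3) by (intro INF_lower) auto
  also have "\<dots> \<le> emeasure M (Z \<union> L) + emeasure M E"
    by (rule emeasure_subadditive) (use Z(3) in auto)
  also have "\<dots> \<le> (emeasure M Z + emeasure M L) + emeasure M E"
    by (intro add_right_mono emeasure_subadditive) (use Z(3) in auto)
  also have "\<dots> \<le> ennreal (exp t * (1/2) ^ K) + ennreal (24 * C * (r * (K + 1)) + 72 * C ^ 3 * (r * (K + 1))\<^sup>2)"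
    using E_le flight_time_tail[of K t] by (auto simp: Z(2) L_def intro!: add_mono)
  also have "\<dots> = ennreal (exp t * (1/2) ^ K + (24 * C * (r * (K + 1)) + 72 * C ^ 3 * (r * (K + 1))\<^sup>2))"
    using r C(1) by (intro ennreal_plus[symmetric]) auto
  finally show ?thesis .
qed

end

theorem theorem1:
  fixes M :: "'a measure"
    and \<xi> :: "nat \<Rightarrow> 'a \<Rightarrow> real"
    and u :: "nat \<Rightarrow> 'a \<Rightarrow> R3"
    and T :: "real \<Rightarrow> real"
  assumes "flight_variables M \<xi> u"
    and "\<And>r. r > 0 \<Longrightarrow> T r > 0"
    and "filterlim T at_top (at_right 0)"
    and "((\<lambda>r. r * T r) \<longlongrightarrow> 0) (at_right 0)"
  shows "((\<lambda>r. outer_measure_of M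
            {\<omega> \<in> space M.
               first_discrepancy
                 (lorentz_process r (\<lambda>j. \<xi> j \<omega>) (\<lambda>j. u j \<omega>))
                 (flight_process (\<lambda>j. \<xi> j \<omega>) (\<lambda>j. u j \<omega>)) \<le> ereal (T r)}) \<longlongrightarrow> 0) (at_right 0)"
    (is "((\<lambda>r. ?P r) \<longlongrightarrow> 0) _")
proof -
  interpret prob_space M using assms(1) by (simp add: flight_variables_def)
  interpret flight M \<xi> u by unfold_locales (rule assms(1))
  obtain C where C: "C > 0"
    "\<And>e. norm e = 1 \<Longrightarrow> (\<integral>\<^sup>+x. inv_sqrt (x \<bullet> e) \<partial>uniform_sphere) \<le> ennreal C"
    "\<And>e. norm e = 1 \<Longrightarrow> (\<integral>\<^sup>+x. inv_norm (transverse e x) \<partial>uniform_sphere) \<le> ennreal C"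
    by (rule uniform_sphere_bounds) (rule that)
  \<comment> \<open>Bounds r (K + 1) when K is at most 2 T + 1.\<close>
  let ?x = "\<lambda>r. 2 * (r * T r) + 2 * r"
  define f where "f r = exp (- (1/3 * T r)) + (24 * C * ?x r + 72 * C ^ 3 * (?x r)\<^sup>2)" for r
  have le: "?P r \<le> ennreal (f r)" if r: "r > 0" for r
  proof -
    \<comment> \<open>Twice the mean number of steps in time T: as 2 ln 2 exceeds 1,
      \<open>exp (T r) * (1/2) ^ K\<close> still decays. With ln 2 at least 2/3, the exponent is at
      most T - (4/3) T = - T/3.\<close>
    define K where "K = nat \<lceil>2 * T r\<rceil>"
    have T: "T r > 0" by (rule assms(2)[OF r])
    have K: "2 * T r \<le> K" "K \<le> 2 * T r + 1" unfolding K_def using T by linarith+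
    have "exp (K * ln 2) = (2::real) ^ K" by (simp add: exp_of_nat_mult)
    then have "exp (T r) * (1/2) ^ K = exp (T r - K * ln 2)"
      unfolding exp_diff power_one_over by simp
    also have "\<dots> \<le> exp (- (1/3 * T r))"
    proof -
      have "2 * T r * (2/3) \<le> K * ln 2"
        using K ln2_ge_two_thirds T by (intro mult_mono) auto
      then show ?thesis by simp
    qed
    finally have 1: "exp (T r) * (1/2) ^ K \<le> exp (- (1/3 * T r))" .
    have "r * (K + 1) \<le> r * (2 * T r + 2)" using K r by (intro mult_left_mono) auto
    then have 2: "r * (K + 1) \<le> ?x r" by (simp add: algebra_simps)
    have "?P r \<le> ennreal (exp (T r) * (1/2) ^ K + (24 * C * (r * (K + 1)) + 72 * C ^ 3 * (r * (K + 1))\<^sup>2))"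
      by (rule outer_measure_discrepancy_le[OF C r])
    also have "\<dots> \<le> ennreal (f r)"
      unfolding f_def using 2 r C(1)
      by (intro ennreal_leI add_mono 1 mult_left_mono power_mono) auto
    finally show ?thesis .
  qed
  have x0: "(?x \<longlongrightarrow> 2 * 0 + 2 * 0) (at_right 0)"
    by (intro tendsto_intros assms(4))
  have "filterlim (\<lambda>r. 1/3 * T r) at_top (at_right 0)"
    by (rule filterlim_tendsto_pos_mult_at_top[OF tendsto_const _ assms(3)]) simp
  then have "filterlim (\<lambda>r. - (1/3 * T r)) at_bot (at_right 0)"
    by (simp add: filterlim_uminus_at_bot)
  then have "((\<lambda>r. exp (- (1/3 * T r))) \<longlongrightarrow> 0) (at_right 0)"
    by (rule filterlim_compose[OF exp_at_bot])
  then have "(f \<longlongrightarrow> 0 + (24 * C * (2 * 0 + 2 * 0) + 72 * C ^ 3 * (2 * 0 + 2 * 0)\<^sup>2)) (at_right 0)"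
    unfolding f_def by (intro tendsto_intros x0)
  then have "((\<lambda>r. ennreal (f r)) \<longlongrightarrow> ennreal 0) (at_right 0)"
    by (intro tendsto_ennrealI) simp
  then have lim: "((\<lambda>r. ennreal (f r)) \<longlongrightarrow> 0) (at_right 0)" by simp
  show ?thesis
  proof (rule tendsto_sandwich[OF _ _ tendsto_const lim])
    show "eventually (\<lambda>r. ?P r \<le> ennreal (f r)) (at_right 0)"
      using le by (auto simp: eventually_at_right_less intro: eventually_mono[OF eventually_at_right_less])
  qed simp
qed

end
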